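(* Suppose there exist $P_i\succ0$ ($n\times n$, $i\in\mathcal I$), a scalar $\rho>0$ and $\Pi=[\pi_{i,j}]_{i,j\in\mathcal I}\in\mathcal M$ such that for all $i\in\mathcal I$ $$\begin{bmatrix} A_i^\top P_i+P_iA_i+\sum_{j\in\mathcal I}\pi_{j,i}P_j&P_iE_i&C_i^\top \\ E_i^\top P_i&-\rho I&F_i^\top \\ C_i&F_i&-I\end{bmatrix}\prec0 .$$ Then the switched feedback law $\sigma(x)=\min\{\operatorname{argmin}_{i\in\mathcal I}x^\top P_ix\}$ makes $x^*=0$ globally asymptotically stable for the switched system $\dot x=A_\sigma x+E_\sigma\psi$, $z=C_\sigma x+F_\sigma\psi$, and ensures that $J_\infty<\rho$.
   Context: $\mathcal I=\{1,\dots,N\}$; $A_i\in\mathbb R^{n\times n}$, $E_i\in\mathbb R^{n\times q}$, $C_i\in\mathbb R^{p\times n}$, $F_i\in\mathbb R^{p\times q}$ for $i\in\mathcal I$. $\mathcal M:=\{\Pi\in\mathbb R^{N\times N}\mid \pi_{i,j}\ge0\ \forall i\ne j,\ \sum_{i=1}^N\pi_{i,j}=0\ \forall j\}$. Solution concept (Filippov-type, allowing sliding motions). Given a disturbance $\psi:\mathbb R_{\ge0}\to\mathbb R^q$, put $\xi_i(x,t):=A_ix+E_i\psi(t)$, $\mathcal X_i:=\{x\in\mathbb R^n\mid\sigma(x)=i\}$, $\mathrm I(x):=\{i\in\mathcal I\mid$ every neighborhood of $x$ meets $\mathcal X_i\}$, $\dot v_i(x,\xi):=x^\top P_i\xi+\xi^\top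 P_ix$. A solution of the closed loop is an absolutely continuous $x:\mathbb R_{\ge0}\to\mathbb R^n$ together with weights $a_i(t)\ge0$ ($i\in\mathrm I(x(t))$), $\sum_{i\in\mathrm I(x(t))}a_i(t)=1$, measurable in $t$, such that for almost all $t$, with $x=x(t)$, $a_i=a_i(t)$, $$\dot x(t)=\sum_{i\in\mathrm I(x)}a_i\xi_i(x,t)\quad\text{and}\quad\dot v_{\sigma(x)}\Big(x,\sum_{i\in\mathrm I(x)}a_i\xi_i(x,t)\Big)\le\sum_{i\in\mathrm I(x)}\dot v_i(x,a_i\xi_i(x,t)).$$ Existence of solutions in this sense is assumed wherever needed. Global asymptotic stability of the origin refers to $\psi\equiv0$: the origin is Lyapunov stable with respect to all such solutions and every such solution converges to $0$ as $t\to\infty$. $\mathcal H_\infty$ index. The modified output is $z_a(t):=\sum_{i\in\mathrm I(x(t))}a_i(t)\,(C_ix(t)+F_i\psi(t))$. Then $J_\infty:=\sup\|z_a\|_2^2/\|\psi\|_2^2$, the supremum being over all $0\neq\psi\in\mathcal L_2$ and all corresponding solutions with $x(0)=0$; here $\|s\|_2^2=\int_0^\infty s(t)^\top s(t)\,dt$ and $\mathcal L_2$ is the set of signals with finite $\|\cdot\|_2$. *)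

theory Defs
  imports "HOL-Analysis.Analysis"
begin

definition pos_definite :: "real^'n^'n \<Rightarrow> bool" where
  "pos_definite M \<longleftrightarrow> transpose M = M \<and> (\<forall>x. x \<noteq> 0 \<longrightarrow> x \<bullet> (M *v x) > 0)"

definition neg_definite :: "real^'n^'n \<Rightarrow> bool" where
  "neg_definite M \<longleftrightarrow> transpose M = M \<and> (\<forall>x. x \<noteq> 0 \<longrightarrow> x \<bullet> (M *v x) < 0)"

text \<open>Rows and columns of a partitioned matrix are indexed by the disjoint sum of the index
  types of the blocks.\<close>

definition block3 ::
  "real^'n^'n \<Rightarrow> real^'q^'n \<Rightarrow> real^'p^'n \<Rightarrow>
   real^'n^'q \<Rightarrow> real^'q^'q \<Rightarrow> real^'p^'q \<Rightarrow>
   real^'n^'p \<Rightarrow> real^'q^'p \<Rightarrow> real^'p^'p \<Rightarrow> real^('n + 'q + 'p)^('n + 'q + 'p)" where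
  "block3 M11 M12 M13 M21 M22 M23 M31 M32 M33 =
    (\<chi> r c.
      (case r of
         Inl i \<Rightarrow>
           (case c of Inl j \<Rightarrow> M11 $ i $ j | Inr (Inl j) \<Rightarrow> M12 $ i $ j | Inr (Inr j) \<Rightarrow> M13 $ i $ j)
       | Inr (Inl i) \<Rightarrow>
           (case c of Inl j \<Rightarrow> M21 $ i $ j | Inr (Inl j) \<Rightarrow> M22 $ i $ j | Inr (Inr j) \<Rightarrow> M23 $ i $ j)
       | Inr (Inr i) \<Rightarrow>
           (case c of Inl j \<Rightarrow> M31 $ i $ j | Inr (Inl j) \<Rightarrow> M32 $ i $ j | Inr (Inr j) \<Rightarrow> M33 $ i $ j)))"

text \<open>The set \<open>\<M>\<close> of matrices with nonnegative off-diagonal entries whose columns sum to zero;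
  only the entries with both indices in \<open>{1..N}\<close> are relevant.\<close>

definition metzler_set :: "nat \<Rightarrow> (nat \<Rightarrow> nat \<Rightarrow> real) set" where
  "metzler_set N = {\<pi>. (\<forall>i\<in>{1..N}. \<forall>j\<in>{1..N}. i \<noteq> j \<longrightarrow> \<pi> i j \<ge> 0) \<and>
                       (\<forall>j\<in>{1..N}. (\<Sum>i\<in>{1..N}. \<pi> i j) = 0)}"

definition min_switching :: "nat \<Rightarrow> (nat \<Rightarrow> real^'n^'n) \<Rightarrow> real^'n \<Rightarrow> nat" where
  "min_switching N P x = Min {i. is_arg_min (\<lambda>i. x \<bullet> (P i *v x)) (\<lambda>i. i \<in> {1..N}) i}"

text \<open>The usual \<open>\<epsilon>\<close>-\<open>\<delta>\<close> definition. A set \<open>D\<close> with \<open>D division_of \<Union>D\<close> is a finite set of nonempty compact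
  intervals with pairwise disjoint interiors.\<close>

definition abs_continuous_on :: "real set \<Rightarrow> (real \<Rightarrow> 'a::real_normed_vector) \<Rightarrow> bool" where
  "abs_continuous_on S f \<longleftrightarrow>
    (\<forall>\<epsilon>>0. \<exists>\<delta>>0. \<forall>D. D division_of \<Union>D \<longrightarrow> \<Union>D \<subseteq> S \<longrightarrow> (\<Sum>K\<in>D. Sup K - Inf K) < \<delta> \<longrightarrow>
       (\<Sum>K\<in>D. norm (f (Sup K) - f (Inf K))) < \<epsilon>)"

definition region :: "(real^'n \<Rightarrow> nat) \<Rightarrow> nat \<Rightarrow> (real^'n) set" where
  "region \<sigma> i = {x. \<sigma> x = i}"

definition active :: "nat \<Rightarrow> (real^'n \<Rightarrow> nat) \<Rightarrow> real^'n \<Rightarrow> nat set" where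
  "active N \<sigma> x = {i \<in> {1..N}. \<forall>U. open U \<longrightarrow> x \<in> U \<longrightarrow> U \<inter> region \<sigma> i \<noteq> {}}"

definition vdot :: "real^'n^'n \<Rightarrow> real^'n \<Rightarrow> real^'n \<Rightarrow> real" where
  "vdot P x \<xi> = x \<bullet> (P *v \<xi>) + \<xi> \<bullet> (P *v x)"

definition vfield ::
  "(nat \<Rightarrow> real^'n^'n) \<Rightarrow> (nat \<Rightarrow> real^'q^'n) \<Rightarrow> (real \<Rightarrow> real^'q) \<Rightarrow>
   nat \<Rightarrow> real^'n \<Rightarrow> real \<Rightarrow> real^'n" where
  "vfield A E \<psi> i x t = A i *v x + E i *v \<psi> t"

text \<open>Signals on \<open>[0,\<infinity>)\<close> are functions on \<open>real\<close> whose values at negative times are irrelevant.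
  Absolute continuity on \<open>[0,\<infinity>)\<close> means absolute continuity on every compact subinterval.
  The weight \<open>a i t\<close> is meaningful only when \<open>i\<close> is active at \<open>x t\<close>, so that its measurability
  is required on the set of those times.\<close>

definition closed_loop_solution ::
  "nat \<Rightarrow> (nat \<Rightarrow> real^'n^'n) \<Rightarrow> (nat \<Rightarrow> real^'q^'n) \<Rightarrow> (nat \<Rightarrow> real^'n^'n) \<Rightarrow>
   (real^'n \<Rightarrow> nat) \<Rightarrow> (real \<Rightarrow> real^'q) \<Rightarrow> (real \<Rightarrow> real^'n) \<Rightarrow> (nat \<Rightarrow> real \<Rightarrow> real) \<Rightarrow> bool" where
  "closed_loop_solution N A E P \<sigma> \<psi> x a \<longleftrightarrow>
     (\<forall>T\<ge>0. abs_continuous_on {0..T} x) \<and>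
     (\<forall>t\<ge>0. \<forall>i\<in>active N \<sigma> (x t). a i t \<ge> 0) \<and>
     (\<forall>t\<ge>0. (\<Sum>i\<in>active N \<sigma> (x t). a i t) = 1) \<and>
     (\<forall>i\<in>{1..N}. a i \<in> borel_measurable (lebesgue_on {t. t \<ge> 0 \<and> i \<in> active N \<sigma> (x t)})) \<and>
     (AE t in lebesgue_on {0..}.
        (x has_vector_derivative
           (\<Sum>i\<in>active N \<sigma> (x t). a i t *\<^sub>R vfield A E \<psi> i (x t) t)) (at t within {0..}) \<and>
        vdot (P (\<sigma> (x t))) (x t) (\<Sum>i\<in>active N \<sigma> (x t). a i t *\<^sub>R vfield A E \<psi> i (x t) t)
          \<le> (\<Sum>i\<in>active N \<sigma> (x t). vdot (P i) (x t) (a i t *\<^sub>R vfield A E \<psi> i (x t) t)))"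

definition origin_GAS ::
  "nat \<Rightarrow> (nat \<Rightarrow> real^'n^'n) \<Rightarrow> (nat \<Rightarrow> real^'q^'n) \<Rightarrow> (nat \<Rightarrow> real^'n^'n) \<Rightarrow>
   (real^'n \<Rightarrow> nat) \<Rightarrow> bool" where
  "origin_GAS N A E P \<sigma> \<longleftrightarrow>
     (\<forall>\<epsilon>>0. \<exists>\<delta>>0. \<forall>x a. closed_loop_solution N A E P \<sigma> (\<lambda>_. 0) x a \<longrightarrow> norm (x 0) < \<delta> \<longrightarrow>
        (\<forall>t\<ge>0. norm (x t) < \<epsilon>)) \<and>
     (\<forall>x a. closed_loop_solution N A E P \<sigma> (\<lambda>_. 0) x a \<longrightarrow> (x \<longlongrightarrow> 0) at_top)"

definition l2_norm_sq :: "(real \<Rightarrow> real^'m) \<Rightarrow> ennreal" where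
  "l2_norm_sq s = (\<integral>\<^sup>+ t. ennreal (s t \<bullet> s t) \<partial>lebesgue_on {0..})"

definition l2_signals :: "(real \<Rightarrow> real^'m) set" where
  "l2_signals = {s. s \<in> borel_measurable (lebesgue_on {0..}) \<and> l2_norm_sq s < \<infinity>}"

definition modified_output ::
  "nat \<Rightarrow> (nat \<Rightarrow> real^'n^'p) \<Rightarrow> (nat \<Rightarrow> real^'q^'p) \<Rightarrow> (real^'n \<Rightarrow> nat) \<Rightarrow>
   (real \<Rightarrow> real^'q) \<Rightarrow> (real \<Rightarrow> real^'n) \<Rightarrow> (nat \<Rightarrow> real \<Rightarrow> real) \<Rightarrow> real \<Rightarrow> real^'p" where
  "modified_output N C F \<sigma> \<psi> x a t =
     (\<Sum>i\<in>active N \<sigma> (x t). a i t *\<^sub>R (C i *v x t + F i *v \<psi> t))"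

text \<open>The supremum is taken in \<open>[0,\<infinity>]\<close>, so no finiteness of the output norm is presupposed. A
  disturbance is nonzero as an element of \<open>L\<^sub>2\<close>, that is, it has nonzero norm.\<close>

definition J_infinity ::
  "nat \<Rightarrow> (nat \<Rightarrow> real^'n^'n) \<Rightarrow> (nat \<Rightarrow> real^'q^'n) \<Rightarrow> (nat \<Rightarrow> real^'n^'p) \<Rightarrow>
   (nat \<Rightarrow> real^'q^'p) \<Rightarrow> (nat \<Rightarrow> real^'n^'n) \<Rightarrow> (real^'n \<Rightarrow> nat) \<Rightarrow> ennreal" where
  "J_infinity N A E C F P \<sigma> =
     Sup {l2_norm_sq (modified_output N C F \<sigma> \<psi> x a) / l2_norm_sq \<psi> | \<psi> x a.
            \<psi> \<in> l2_signals \<and> l2_norm_sq \<psi> \<noteq> 0 \<and>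
            closed_loop_solution N A E P \<sigma> \<psi> x a \<and> x 0 = 0}"

end

theory Submission
  imports Defs
begin

text \<open>
  The Lyapunov function is \<open>V x = min\<^sub>i x\<^sup>T P\<^sub>i x\<close>. Every mode \<open>i\<close> active at \<open>x\<close> attains the minimum, so the
  Metzler term \<open>\<Sum>\<^sub>j \<pi>\<^sub>j\<^sub>i x\<^sup>T P\<^sub>j x\<close> is at least \<open>V x \<Sum>\<^sub>j \<pi>\<^sub>j\<^sub>i = 0\<close>. By compactness the strict matrix
  inequality holds with a margin \<open>c > 0\<close>, and averaging over the weights (with Jensen's inequality for
  the output) bounds the derivative of \<open>V\<close> along solutions by \<open>(\<rho> - c) |\<psi>|\<^sup>2 - c |x|\<^sup>2 - |z\<^sub>a|\<^sup>2\<close>.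
  Although \<open>V\<close> is not differentiable, \<open>V \<le> x\<^sup>T P\<^sub>\<sigma> x\<close> with equality at the current state, which bounds the
  right upper derivative of \<open>V\<close> along the solution; for absolutely continuous functions this suffices to
  integrate the estimate.
\<close>

subsection \<open>Integrating a bound on the right upper derivative\<close>

text \<open>Only the right upper derivative of \<open>f\<close> is controlled, so a gauge partition into intervals tagged
  at their left endpoints need not exist. Vitali's covering theorem supplies finitely many such
  intervals filling \<open>[a, b]\<close> up to small measure; Henstock's lemma compares \<open>f\<close> with \<open>g\<close> on them, and
  absolute continuity makes the increments of \<open>f\<close> over the gaps negligible.\<close>

lemma ac_right_derivative_bound:
  fixes f g :: "real \<Rightarrow> real"
  assumes "a \<le> b"
    and ac: "abs_continuous_on {a..b} f"
    and g: "g absolutely_integrable_on {a..b}"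
    and Z: "negligible Z"
    and D: "\<And>t e. \<lbrakk>a \<le> t; t < b; t \<notin> Z; e > 0\<rbrakk> \<Longrightarrow>
              \<exists>d>0. \<forall>s. t < s \<and> s < t + d \<and> s \<le> b \<longrightarrow> f s - f t \<le> (g t + e) * (s - t)"
  shows "f b - f a \<le> integral {a..b} g"
proof (rule field_le_epsilon)
  fix e0 :: real assume "e0 > 0"
  \<comment> \<open>The error budget is three shares \<open>e\<close> plus
    \<open>e * (b - a)\<close>: one share for replacing the integral of \<open>g\<close> over the
    covered set by that over [a, b], one for Henstock's lemma, one for the increments of
    \<open>f\<close> over the gaps, and \<open>e * (b - a)\<close> for the slack \<open>e\<close> in
    the derivative bound.\<close>
  define e where "e = e0 / (3 + (b - a))"
  have e: "e > 0"
    using \<open>e0 > 0\<close> \<open>a \<le> b\<close> by (simp add: e_def)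
  have "e0 = e * (3 + (b - a))"
    using \<open>a \<le> b\<close> by (simp add: e_def)
  then have e0: "e0 = 3 * e + e * (b - a)"
    by (simp add: distrib_left)
  have gi: "g integrable_on {a..b}"
    using g by (simp add: absolutely_integrable_on_def)
  obtain \<gamma> where \<gamma>: "gauge \<gamma>"
    and hen: "\<And>p. \<lbrakk>p tagged_partial_division_of (cbox a b); \<gamma> fine p\<rbrakk> \<Longrightarrow>
             sum (\<lambda>(x,k). norm(measure lborel k *\<^sub>R g x - integral k g)) p < e"
    using Henstock_lemma[of g a b e] gi e by auto
  obtain \<delta> where \<delta>: "\<delta> > 0" and ac\<delta>:
    "\<And>D. D division_of \<Union>D \<Longrightarrow> \<Union>D \<subseteq> {a..b} \<Longrightarrow> (\<Sum>K\<in>D. Sup K - Inf K) < \<delta> \<Longrightarrow>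
       (\<Sum>K\<in>D. norm (f (Sup K) - f (Inf K))) < e"
    using ac e unfolding abs_continuous_on_def by meson
  \<comment> \<open>A pair holds the left endpoint, which also serves as tag, and the length.
    Membership in \<V> demands both that the interval be \<gamma>-fine for this tag and that the
    difference quotient of \<open>f\<close> be controlled on it.\<close>
  define I :: "real \<times> real \<Rightarrow> real set" where "I = (\<lambda>i. {fst i..fst i + snd i})"
  define \<V> where "\<V> = {(t,h). a \<le> t \<and> 0 < h \<and> t + h \<le> b \<and> I (t,h) \<subseteq> \<gamma> t \<and>
                       f (t + h) - f t \<le> (g t + e) * h}"
  \<comment> \<open>Vitali's theorem speaks of balls; each interval is the closed ball about its
    midpoint with half its length as radius.\<close>
  have cb: "cball (fst i + snd i / 2) (snd i / 2) = I i" for i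
    by (auto simp: I_def cball_eq_atLeastAtMost)
  have fine_cover: "\<exists>i. i \<in> \<V> \<and> t \<in> I i \<and> snd i / 2 < d"
    if t: "t \<in> {a..<b} - Z" and d: "d > 0" for t d
  proof -
    obtain d1 where d1: "d1 > 0" "\<And>s. t < s \<Longrightarrow> s < t + d1 \<Longrightarrow> s \<le> b \<Longrightarrow> f s - f t \<le> (g t + e) * (s - t)"
      using D[of t e] t e by auto
    obtain d2 where d2: "d2 > 0" "ball t d2 \<subseteq> \<gamma> t"
      using \<gamma> by (meson gauge_def openE)
    define h where "h = min (min d d1) (min d2 (b - t)) / 2"
    have h: "h > 0" "h < d" "h < d1" "h < d2" "t + h \<le> b"
      using d d1 d2 t by (auto simp: h_def min_def field_simps)
    have "I (t,h) \<subseteq> ball t d2"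
      using h by (auto simp: I_def dist_real_def)
    then have "(t,h) \<in> \<V>"
      using d1(2)[of "t+h"] h d2 t by (auto simp: \<V>_def)
    then show ?thesis using h by (intro exI[of _ "(t,h)"]) (auto simp: I_def)
  qed
  obtain C where C: "countable C" "C \<subseteq> \<V>"
    and disj: "pairwise (\<lambda>i j. disjnt (I i) (I j)) C"
    and neg: "negligible (({a..<b} - Z) - (\<Union>i \<in> C. I i))"
  proof (rule Vitali_covering_theorem_cballs[of \<V> "\<lambda>i. snd i / 2" "{a..<b} - Z" "\<lambda>i. fst i + snd i / 2", unfolded cb])
    show "0 < snd i / 2" if "i \<in> \<V>" for i using that by (auto simp: \<V>_def)
  qed (use fine_cover in auto)
  \<comment> \<open>The first \<open>n\<close> members in an enumeration of \<open>C\<close>.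
    Intersecting with \<open>C\<close> discards the arbitrary value that
    \<open>from_nat_into\<close> returns when \<open>C\<close> is empty.\<close>
  define Cn where "Cn = (\<lambda>n. C \<inter> from_nat_into C ` {..<n})"
  define S where "S = (\<lambda>n. \<Union>i\<in>Cn n. I i)"
  have finC: "finite (Cn n)" for n by (simp add: Cn_def)
  have sub: "I i \<subseteq> {a..b}" if "i \<in> C" for i
    using that C by (auto simp: \<V>_def I_def)
  have closedS: "S n \<in> sets lebesgue" for n
    unfolding S_def I_def using finC by (intro sets.finite_UN) auto
  have Ssub: "S n \<subseteq> {a..b}" for n using sub by (auto simp: S_def Cn_def)
  \<comment> \<open>The sets \<open>S n\<close> grow to the union of the Vitali family, which misses
    only a null set of [a, b]; dominated convergence with dominating function |h| applies.\<close>
  have exhaust: "(\<lambda>n. integral (S n) h) \<longlonglongrightarrow> integral {a..b} h"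
    if h: "h absolutely_integrable_on {a..b}" for h :: "real \<Rightarrow> real"
  proof -
    let ?U = "\<Union>i\<in>C. I i"
    have int: "(\<lambda>x. if x \<in> S n then h x else 0) integrable_on {a..b}" for n
    proof -
      have "h absolutely_integrable_on (S n)"
        by (rule set_integrable_subset[OF h closedS Ssub])
      then show ?thesis
        using Ssub[of n] by (simp add: integrable_restrict_Int absolutely_integrable_on_def inf_absorb1)
    qed
    have "(\<lambda>n. integral {a..b} (\<lambda>x. if x \<in> S n then h x else 0)) \<longlonglongrightarrow>
            integral {a..b} (\<lambda>x. if x \<in> ?U then h x else 0)"
    proof (rule dominated_convergence(2)[where h="\<lambda>x. norm (h x)"])
      show "(\<lambda>x. norm (h x)) integrable_on {a..b}"
        using h by (simp add: absolutely_integrable_on_def)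
      fix x
      show "(\<lambda>n. if x \<in> S n then h x else 0) \<longlonglongrightarrow> (if x \<in> ?U then h x else 0)"
      proof (cases "x \<in> ?U")
        case True
        then obtain i where i: "i \<in> C" "x \<in> I i" by auto
        then obtain m where m: "from_nat_into C m = i"
          using from_nat_into_surj[OF C(1)] by blast
        have "x \<in> S n" if "n > m" for n
          using i m that by (auto simp: S_def Cn_def)
        then have "\<forall>\<^sub>F n in sequentially. (if x \<in> S n then h x else 0) = h x"
          by (intro eventually_mono[OF eventually_gt_at_top[of m]]) auto
        then show ?thesis using True by (simp add: tendsto_eventually)
      next
        case False
        then have "x \<notin> S n" for n by (auto simp: S_def Cn_def)
        then show ?thesis using False by simp
      qed
    qed (use int in auto)
    moreover have "integral {a..b} (\<lambda>x. if x \<in> ?U then h x else 0) = integral {a..b} h"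
    proof (rule integral_spike)
      have "negligible ((({a..<b} - Z) - ?U) \<union> Z \<union> {b})"
        using neg Z by (simp add: negligible_Un)
      then show "negligible ({a..b} - ?U)"
        by (rule negligible_subset) auto
    qed auto
    moreover have "integral {a..b} (\<lambda>x. if x \<in> S n then h x else 0) = integral (S n) h" for n
      using Ssub[of n] by (simp add: integral_restrict_Int inf_absorb1)
    ultimately show ?thesis by simp
  qed
  have "\<forall>\<^sub>F n in sequentially. integral (S n) g < integral {a..b} g + e"
    using exhaust[OF g] e by (intro order_tendstoD) auto
  moreover have one: "(\<lambda>x. 1::real) absolutely_integrable_on {a..b}"
    by simp
  have "\<forall>\<^sub>F n in sequentially. integral (S n) (\<lambda>x. 1) > (b - a) - \<delta>"
    using exhaust[OF one] \<delta> \<open>a \<le> b\<close> by (intro order_tendstoD) auto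
  ultimately have "\<forall>\<^sub>F n in sequentially. integral (S n) g < integral {a..b} g + e \<and> integral (S n) (\<lambda>x. 1) > (b - a) - \<delta>"
    by eventually_elim auto
  \<comment> \<open>Using \<open>h = g\<close> and \<open>h = 1\<close>, one \<open>n\<close> makes
    the integral of \<open>g\<close> over \<open>S n\<close> nearly that over [a, b] and leaves gaps
    of total length below \<delta>.\<close>
  then obtain n where n: "integral (S n) g < integral {a..b} g + e"
      "integral (S n) (\<lambda>x. 1) > (b - a) - \<delta>"
    by (auto simp: eventually_sequentially)
  define p where "p = I ` Cn n"
  have hpos: "snd i > 0" if "i \<in> Cn n" for i using that C by (auto simp: Cn_def \<V>_def)
  have inf: "Inf (I i) = fst i" "Sup (I i) = fst i + snd i" "measure lborel (I i) = snd i" if "i \<in> Cn n" for i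
    using hpos[OF that] by (auto simp: I_def)
  have injI: "inj_on I (Cn n)"
  proof (rule inj_onI)
    fix i j assume "i \<in> Cn n" "j \<in> Cn n" "I i = I j"
    then have "fst i = fst j" "snd i = snd j" using inf by metis+
    then show "i = j" by (simp add: prod_eq_iff)
  qed
  have disjI: "I i \<inter> I j = {}" if "i \<in> Cn n" "j \<in> Cn n" "i \<noteq> j" for i j
    using disj that by (auto simp: pairwise_def disjnt_def Cn_def)
  have pdiv: "p division_of \<Union>p"
  proof (rule division_ofI)
    show "finite p" by (simp add: p_def finC)
    show "K \<noteq> {}" "\<exists>a b. K = cbox a b" if "K \<in> p" for K
      using that hpos unfolding p_def by (auto simp: I_def less_imp_le)
    show "interior K1 \<inter> interior K2 = {}" if "K1 \<in> p" "K2 \<in> p" "K1 \<noteq> K2" for K1 K2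
      using that disjI interior_subset unfolding p_def by blast
  qed auto
  have Up: "\<Union>p = S n" by (simp add: p_def S_def)
  \<comment> \<open>Completing \<open>p\<close> to a division \<open>q\<close> of the whole interval
    makes the gaps explicit: they are the members of \<open>q - p\<close>. Increments over
    \<open>q\<close> then telescope.\<close>
  obtain q where q: "p \<subseteq> q" "q division_of cbox a b"
    using partial_division_extend_interval[OF pdiv] Ssub[of n] Up by auto
  have finq: "finite q" using q by auto
  have K: "K \<noteq> {} \<and> K = {Inf K..Sup K} \<and> Inf K \<le> Sup K \<and> measure lborel K = Sup K - Inf K \<and> Inf K \<in> K \<and> K \<subseteq> {a..b}" if KK: "K \<in> q" for K
  proof -
    obtain u v where "K = cbox u v" "K \<noteq> {}" using division_ofD[OF q(2)] KK by metis
    then show ?thesis using division_ofD(2)[OF q(2) KK] by auto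
  qed
  define q' where "q' = (\<lambda>K. (Inf K, K)) ` q"
  have injq: "inj_on (\<lambda>K. (Inf K, K)) Q" for Q :: "real set set" by (auto simp: inj_on_def)
  have tq: "q' tagged_division_of {a..b}"
  proof (rule tagged_division_ofI)
    show "\<And>x1 K1 x2 K2. (x1, K1) \<in> q' \<Longrightarrow> (x2, K2) \<in> q' \<Longrightarrow> (x1, K1) \<noteq> (x2, K2) \<Longrightarrow> interior K1 \<inter> interior K2 = {}"
      using division_ofD(5)[OF q(2)] by (auto simp: q'_def)
    show "\<Union>{K. \<exists>x. (x, K) \<in> q'} = {a..b}"
      using division_ofD(6)[OF q(2)] by (auto simp: q'_def image_iff)
    show "\<exists>a b. K = cbox a b" if "(x, K) \<in> q'" for x K
      using division_ofD(4)[OF q(2), of K] that by (auto simp: q'_def)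
  qed (use K finq in \<open>auto simp: q'_def\<close>)
  have telescope: "(\<Sum>K\<in>q. F (Sup K) - F (Inf K)) = F b - F a" for F :: "real \<Rightarrow> real"
    using additive_tagged_division_1[OF \<open>a \<le> b\<close> tq, of F]
    by (simp add: q'_def sum.reindex injq)
  have split: "(\<Sum>K\<in>q. F K) = (\<Sum>K\<in>p. F K) + (\<Sum>K\<in>q - p. F K)" for F :: "real set \<Rightarrow> real"
    using sum.subset_diff[OF q(1) finq, of F] by simp
  have sump: "integral (S n) h = (\<Sum>K\<in>p. integral K h)" if "h integrable_on {a..b}" for h :: "real \<Rightarrow> real"
    using has_integral_combine_division_topdown[OF that pdiv] Ssub[of n] Up by auto
  have len: "(\<Sum>K\<in>p. Sup K - Inf K) = integral (S n) (\<lambda>x. 1)"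
  proof -
    have "integral K (\<lambda>x. 1) = Sup K - Inf K" if "K \<in> p" for K
    proof -
      have "K = {Inf K..Sup K}" "Inf K \<le> Sup K" using K that q(1) by auto
      then obtain u v where "K = {u..v}" "u \<le> v" by blast
      then show ?thesis by simp
    qed
    then have "(\<Sum>K\<in>p. Sup K - Inf K) = (\<Sum>K\<in>p. integral K (\<lambda>x. 1))"
      by (intro sum.cong) auto
    then show ?thesis using sump[OF integrable_const_ivl, of 1] by simp
  qed
  \<comment> \<open>The gaps have total length \<open>b - a\<close> minus the length of
    \<open>S n\<close>, hence less than \<delta>, and absolute continuity applies.\<close>
  have r: "(\<Sum>K\<in>q - p. norm (f (Sup K) - f (Inf K))) < e"
  proof (rule ac\<delta>)
    show "(q - p) division_of \<Union>(q - p)"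
      using division_of_subset[OF division_of_union_self[OF q(2)]] by auto
    show "\<Union>(q - p) \<subseteq> {a..b}" using K by auto
    show "(\<Sum>K\<in>q - p. Sup K - Inf K) < \<delta>"
      using split[of "\<lambda>K. Sup K - Inf K"] telescope[of "\<lambda>x. x"] len n by auto
  qed
  have r': "(\<Sum>K\<in>q - p. f (Sup K) - f (Inf K)) < e"
    by (rule le_less_trans[OF sum_mono r]) simp
  have "(\<lambda>K. (Inf K, K)) ` p tagged_partial_division_of cbox a b"
    using tq q(1) unfolding tagged_division_of_def q'_def
    by (auto intro: tagged_partial_division_subset)
  moreover have "\<gamma> fine (\<lambda>K. (Inf K, K)) ` p"
  proof (rule fineI)
    fix t K assume "(t, K) \<in> (\<lambda>K. (Inf K, K)) ` p"
    then obtain i where i: "i \<in> Cn n" "K = I i" "t = fst i" using inf by (auto simp: p_def)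
    then have "i \<in> \<V>" using C(2) by (auto simp: Cn_def)
    then show "K \<subseteq> \<gamma> t" using i by (auto simp: \<V>_def)
  qed
  ultimately have "(\<Sum>K\<in>p. norm (measure lborel K *\<^sub>R g (Inf K) - integral K g)) < e"
    using hen[of "(\<lambda>K. (Inf K, K)) ` p"] by (simp add: sum.reindex injq)
  \<comment> \<open>Membership in \<V> bounds the increment over \<open>K\<close> by
    \<open>(g (Inf K) + e)\<close> times its length. Replacing \<open>g (Inf K)\<close> times the
    length by the integral of \<open>g\<close> over \<open>K\<close> costs a term whose sum
    Henstock's lemma keeps below \<open>e\<close>.\<close>
  moreover have "(\<Sum>K\<in>p. f (Sup K) - f (Inf K))
      \<le> (\<Sum>K\<in>p. integral K g + norm (measure lborel K *\<^sub>R g (Inf K) - integral K g) + e * (Sup K - Inf K))"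
  proof (rule sum_mono)
    fix K assume "K \<in> p"
    then obtain i where i: "i \<in> Cn n" "K = I i" by (auto simp: p_def)
    then have "i \<in> \<V>" using C by (auto simp: Cn_def)
    then have "f (Sup K) - f (Inf K) \<le> (g (Inf K) + e) * measure lborel K"
      using inf[OF i(1)] i by (auto simp: \<V>_def)
    also have "\<dots> = measure lborel K *\<^sub>R g (Inf K) + e * (Sup K - Inf K)"
      using inf[OF i(1)] i by (simp add: algebra_simps)
    finally show "f (Sup K) - f (Inf K) \<le> integral K g + norm (measure lborel K *\<^sub>R g (Inf K) - integral K g) + e * (Sup K - Inf K)"
      by (auto simp: abs_if)
  qed
  then have "(\<Sum>K\<in>p. f (Sup K) - f (Inf K)) \<le> integral (S n) g +
     (\<Sum>K\<in>p. norm (measure lborel K *\<^sub>R g (Inf K) - integral K g)) + e * (\<Sum>K\<in>p. Sup K - Inf K)"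
    by (simp add: sum.distrib sump[OF gi] sum_distrib_left)
  moreover have "(\<Sum>K\<in>p. Sup K - Inf K) \<le> b - a"
    using split[of "\<lambda>K. Sup K - Inf K"] telescope[of "\<lambda>x. x"] K
    by (smt (verit) DiffD1 atLeastAtMost_iff sum_nonneg)
  then have "e * (\<Sum>K\<in>p. Sup K - Inf K) \<le> e * (b - a)" using e by simp
  ultimately show "f b - f a \<le> integral {a..b} g + e0"
    using telescope[of f] split[of "\<lambda>K. f (Sup K) - f (Inf K)"] r' n(1) e0 by linarith
qed

subsection \<open>Quadratic forms and the matrix inequality\<close>

lemma continuous_on_quadratic_form:
  "continuous_on S (\<lambda>x::real^'n. x \<bullet> (M *v x))"
  by (intro continuous_intros linear_continuous_on matrix_vector_mul_bounded_linear)

text \<open>The form attains a positive minimum on the compact unit sphere, and homogeneity of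
  degree two carries this value to every vector. This is the source of the strict margins used
  below.\<close>

lemma quadratic_form_coercive:
  fixes M :: "real^'n^'n"
  assumes "\<And>x. x \<noteq> 0 \<Longrightarrow> x \<bullet> (M *v x) > 0"
  shows "\<exists>c>0. \<forall>x. c * (x \<bullet> x) \<le> x \<bullet> (M *v x)"
proof -
  have "sphere (0::real^'n) 1 \<noteq> {}"
    by simp
  then obtain u where u: "u \<in> sphere 0 1" and
    min: "\<And>y. y \<in> sphere 0 1 \<Longrightarrow> u \<bullet> (M *v u) \<le> y \<bullet> (M *v y)"
    using continuous_attains_inf[OF compact_sphere _ continuous_on_quadratic_form] by metis
  have "(u \<bullet> (M *v u)) * (x \<bullet> x) \<le> x \<bullet> (M *v x)" for x
  proof (cases "x = 0")
    case False
    then have "u \<bullet> (M *v u) \<le> (x /\<^sub>R norm x) \<bullet> (M *v (x /\<^sub>R norm x))"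
      by (intro min) simp
    then show ?thesis
      using False
      by (simp add: matrix_vector_mult_scaleR field_simps dot_square_norm power2_eq_square)
  qed simp
  moreover have "u \<bullet> (M *v u) > 0"
    using u by (intro assms) auto
  ultimately show ?thesis
    by blast
qed

lemma bilinear_form_bound:
  fixes M :: "real^'n^'n"
  shows "\<exists>B>0. \<forall>x y. \<bar>x \<bullet> (M *v y)\<bar> \<le> B * norm x * norm y"
proof -
  obtain B where B: "B > 0" "\<And>y. norm (M *v y) \<le> norm y * B"
    using bounded_linear.pos_bounded[OF matrix_vector_mul_bounded_linear] by blast
  have "\<bar>x \<bullet> (M *v y)\<bar> \<le> B * norm x * norm y" for x y
  proof -
    have "\<bar>x \<bullet> (M *v y)\<bar> \<le> norm x * norm (M *v y)"
      by (rule Cauchy_Schwarz_ineq2)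
    also have "\<dots> \<le> norm x * (norm y * B)"
      using B by (intro mult_left_mono) auto
    finally show ?thesis by (simp add: mult_ac)
  qed
  with B show ?thesis by blast
qed

text \<open>Splitting the difference as x.M(x - y) + (x - y).My leaves two bilinear terms, each
  containing the factor x - y. The result is a Lipschitz bound on bounded sets.\<close>

lemma quadratic_form_diff_bound:
  fixes M :: "real^'n^'n"
  shows "\<exists>B>0. \<forall>x y. \<bar>x \<bullet> (M *v x) - y \<bullet> (M *v y)\<bar> \<le> B * (norm x + norm y) * norm (x - y)"
proof -
  obtain B where B: "B > 0" "\<And>x y. \<bar>x \<bullet> (M *v y)\<bar> \<le> B * norm x * norm y"
    using bilinear_form_bound[of M] by blast
  have "\<bar>x \<bullet> (M *v x) - y \<bullet> (M *v y)\<bar> \<le> B * (norm x + norm y) * norm (x - y)" for x y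
  proof -
    have "x \<bullet> (M *v x) - y \<bullet> (M *v y) = x \<bullet> (M *v (x - y)) + (x - y) \<bullet> (M *v y)"
      by (simp add: algebra_simps inner_simps)
    then show ?thesis
      using B(2)[of x "x - y"] B(2)[of "x - y" y] by (simp add: algebra_simps)
  qed
  with B show ?thesis by blast
qed

lemma quadratic_form_has_derivative:
  assumes "(x has_vector_derivative v) (at t within S)"
  shows "((\<lambda>s. x s \<bullet> (M *v x s)) has_real_derivative vdot M (x t) v) (at t within S)"
proof -
  have "((\<lambda>s. M *v x s) has_vector_derivative M *v v) (at t within S)"
    using bounded_linear.has_vector_derivative[OF matrix_vector_mul_bounded_linear assms] .
  then show ?thesis
    using assms unfolding has_vector_derivative_def has_field_derivative_def vdot_def
    by (auto intro!: derivative_eq_intros simp: algebra_simps inner_simps)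
qed

lemma vdot_scaleR [simp]: "vdot M x (r *\<^sub>R v) = r * vdot M x v"
  by (simp add: vdot_def matrix_vector_mult_scaleR algebra_simps)

text \<open>Testing a partitioned matrix on the stacked vector \<open>w\<close> turns its
  definiteness into an inequality between the three component vectors.\<close>

lemma inner_block3:
  fixes x :: "real^'n" and y :: "real^'q" and z :: "real^'p"
  defines "w \<equiv> \<chi> r. case r of Inl i \<Rightarrow> x $ i | Inr (Inl i) \<Rightarrow> y $ i | Inr (Inr i) \<Rightarrow> z $ i"
  shows "w \<bullet> (block3 M11 M12 M13 M21 M22 M23 M31 M32 M33 *v w) =
           x \<bullet> (M11 *v x + M12 *v y + M13 *v z) + y \<bullet> (M21 *v x + M22 *v y + M23 *v z)
           + z \<bullet> (M31 *v x + M32 *v y + M33 *v z)"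
    and "w \<bullet> w = x \<bullet> x + y \<bullet> y + z \<bullet> z"
proof -
  have split: "(\<Sum>r\<in>UNIV. h r) = (\<Sum>i\<in>UNIV. h (Inl i)) + (\<Sum>i\<in>UNIV. h (Inr (Inl i))) + (\<Sum>i\<in>UNIV. h (Inr (Inr i)))"
    for h :: "'n + 'q + 'p \<Rightarrow> real"
    by (simp add: UNIV_Plus_UNIV[symmetric] sum.Plus add.assoc del: UNIV_Plus_UNIV)
  show "w \<bullet> w = x \<bullet> x + y \<bullet> y + z \<bullet> z"
    by (simp add: w_def inner_vec_def split)
  show "w \<bullet> (block3 M11 M12 M13 M21 M22 M23 M31 M32 M33 *v w) =
           x \<bullet> (M11 *v x + M12 *v y + M13 *v z) + y \<bullet> (M21 *v x + M22 *v y + M23 *v z)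
           + z \<bullet> (M31 *v x + M32 *v y + M33 *v z)"
    by (simp add: w_def block3_def inner_vec_def matrix_vector_mult_def split)
qed

lemma matrix_vector_mult_minus_left: "(- M) *v x = - (M *v (x::real^'n))"
  by (simp add: matrix_vector_mult_def vec_eq_iff sum_negf)

lemma matrix_vector_mult_sum_scaleR:
  "(\<Sum>j\<in>J. r j *\<^sub>R M j) *v x = (\<Sum>j\<in>J. r j *\<^sub>R (M j *v (x::real^'n)))"
  by (induction J rule: infinite_finite_induct)
     (auto simp: matrix_vector_mult_add_rdistrib scaleR_matrix_vector_assoc)

text \<open>Eliminating the third block by its optimal choice \<open>z = C x + F y\<close> is the Schur complement of
  the matrix inequality.\<close>

lemma bounded_real_lmi_dissipation:
  fixes A P M :: "real^'n^'n" and E :: "real^'q^'n" and C :: "real^'n^'p" and F :: "real^'q^'p"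
  assumes "neg_definite (block3
           (transpose A ** P + P ** A + M) (P ** E) (transpose C)
           (transpose E ** P) (- (\<rho> *\<^sub>R mat 1)) (transpose F)
           C F (- mat 1))" (is "neg_definite ?L")
  shows "\<exists>c>0. \<forall>x y. vdot P x (A *v x + E *v y) + x \<bullet> (M *v x) + (norm (C *v x + F *v y))\<^sup>2
             \<le> (\<rho> - c) * (y \<bullet> y) - c * (x \<bullet> x)"
proof -
  \<comment> \<open>Coercivity of the negated matrix supplies the uniform margin
    \<open>c\<close>.\<close>
  have "w \<bullet> ((- ?L) *v w) > 0" if "w \<noteq> 0" for w
    using assms that by (simp add: neg_definite_def matrix_vector_mult_minus_left)
  then obtain c where c: "c > 0" "\<And>w. c * (w \<bullet> w) \<le> w \<bullet> ((- ?L) *v w)"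
    using quadratic_form_coercive[of "- ?L"] by blast
  have "vdot P x (A *v x + E *v y) + x \<bullet> (M *v x) + (norm (C *v x + F *v y))\<^sup>2
             \<le> (\<rho> - c) * (y \<bullet> y) - c * (x \<bullet> x)" for x y
  proof -
    define z where "z = C *v x + F *v y"
    define w :: "real^('n + 'q + 'p)"
      where "w = (\<chi> r. case r of Inl i \<Rightarrow> x $ i | Inr (Inl i) \<Rightarrow> y $ i | Inr (Inr i) \<Rightarrow> z $ i)"
    have tr: "v \<bullet> (u v* B) = (B *v v) \<bullet> u" for B :: "real^'r^'s" and u v
      by (metis dot_lmul_matrix inner_commute)
    have "w \<bullet> (?L *v w) \<le> - c * (w \<bullet> w)"
      using c(2)[of w] by (simp add: matrix_vector_mult_minus_left)
    then have "x \<bullet> ((transpose A ** P + P ** A + M) *v x + (P ** E) *v y + transpose C *v z)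
        + y \<bullet> ((transpose E ** P) *v x + (- (\<rho> *\<^sub>R mat 1)) *v y + transpose F *v z)
        + z \<bullet> (C *v x + F *v y + (- mat 1) *v z) \<le> - c * (x \<bullet> x + y \<bullet> y + z \<bullet> z)"
      unfolding w_def inner_block3 .
    \<comment> \<open>For this \<open>z\<close> the two transposed terms add up to |z|^2 while the
      third block row contributes 0, so |z|^2 survives with coefficient one. The remaining term -c
      |z|^2 on the right is dropped later.\<close>
    moreover have "x \<bullet> (transpose C *v z) + y \<bullet> (transpose F *v z) = z \<bullet> z"
      by (simp add: tr z_def inner_simps)
    moreover have "z \<bullet> (C *v x + F *v y + (- mat 1) *v z) = 0"
      by (simp add: z_def matrix_vector_mult_minus_left)
    moreover have "vdot P x (A *v x + E *v y) = x \<bullet> ((transpose A ** P + P ** A) *v x)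
        + x \<bullet> ((P ** E) *v y) + y \<bullet> ((transpose E ** P) *v x)"
      by (simp add: vdot_def matrix_vector_mul_assoc[symmetric] tr matrix_vector_mult_add_rdistrib
          matrix_vector_right_distrib inner_simps)
    moreover have "(- (\<rho> *\<^sub>R mat 1)) *v y = - \<rho> *\<^sub>R y"
      by (simp add: matrix_vector_mult_minus_left flip: scaleR_matrix_vector_assoc)
    moreover have "c * (z \<bullet> z) \<ge> 0" using c by simp
    ultimately show ?thesis
      by (simp add: matrix_vector_mult_add_rdistrib inner_simps algebra_simps dot_square_norm
          flip: z_def)
  qed
  with c show ?thesis by blast
qed

subsection \<open>The minimum of the quadratic forms\<close>

definition min_value :: "nat \<Rightarrow> (nat \<Rightarrow> real^'n^'n) \<Rightarrow> real^'n \<Rightarrow> real" where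
  "min_value N P x = Min ((\<lambda>i. x \<bullet> (P i *v x)) ` {1..N})"

lemma min_value_le: "i \<in> {1..N} \<Longrightarrow> min_value N P x \<le> x \<bullet> (P i *v x)"
  by (simp add: min_value_def)

lemma min_switching_arg_min:
  assumes "N \<ge> 1"
  shows "min_switching N P x \<in> {1..N}"
    and "x \<bullet> (P (min_switching N P x) *v x) = min_value N P x"
proof -
  let ?f = "\<lambda>i. x \<bullet> (P i *v x)"
  let ?S = "{i. is_arg_min ?f (\<lambda>i. i \<in> {1..N}) i}"
  have "?S \<subseteq> {1..N}" by (auto simp: is_arg_min_def)
  moreover have "?S \<noteq> {}"
    using ex_is_arg_min_if_finite[of "{1..N}" ?f] assms by auto
  ultimately have mem: "min_switching N P x \<in> ?S"
    unfolding min_switching_def by (intro Min_in finite_subset[OF _ finite_atLeastAtMost])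
  then show 1: "min_switching N P x \<in> {1..N}"
    by (simp add: is_arg_min_def)
  show "?f (min_switching N P x) = min_value N P x"
    unfolding min_value_def using mem 1
    by (intro Min_eqI[symmetric]) (auto simp: is_arg_min_linorder)
qed

lemma active_iff_closure: "i \<in> active N \<sigma> x \<longleftrightarrow> i \<in> {1..N} \<and> x \<in> closure (region \<sigma> i)"
proof -
  have "x \<in> closure R \<longleftrightarrow> (\<forall>U. open U \<longrightarrow> x \<in> U \<longrightarrow> U \<inter> R \<noteq> {})" for R :: "(real^'a) set"
    by (meson closure_iff_nhds_not_empty disjoint_iff open_Int_closure_eq_empty)
  then show ?thesis by (simp add: active_def)
qed

lemma active_subset: "active N \<sigma> x \<subseteq> {1..N}"
  by (auto simp: active_def)

text \<open>On the region of mode \<open>i\<close> its form is below every other form. This is a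
  closed condition, so it persists on the closure of the region, where an active mode may fail to be
  the selected one.\<close>

lemma active_min_switching_value:
  assumes "N \<ge> 1" "i \<in> active N (min_switching N P) x"
  shows "x \<bullet> (P i *v x) = min_value N P x"
proof -
  let ?\<sigma> = "min_switching N P"
  have i: "i \<in> {1..N}" "x \<in> closure (region ?\<sigma> i)"
    using assms by (auto simp: active_iff_closure)
  have "x \<bullet> (P i *v x) \<le> x \<bullet> (P j *v x)" if "j \<in> {1..N}" for j
  proof -
    have "region ?\<sigma> i \<subseteq> {y. y \<bullet> (P i *v y) \<le> y \<bullet> (P j *v y)}"
      using min_switching_arg_min(2)[OF assms(1), where P=P] min_value_le[OF that, where P=P]
      by (auto simp: region_def)
    moreover have "closed {y. y \<bullet> (P i *v y) \<le> y \<bullet> (P j *v y)}"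
      by (intro closed_Collect_le continuous_on_quadratic_form)
    ultimately show ?thesis
      using i(2) closure_minimal by blast
  qed
  then show ?thesis
    unfolding min_value_def using i by (intro Min_eqI[symmetric]) auto
qed

text \<open>Since column \<open>i\<close> of \<pi> sums to zero, \<open>v i\<close> may be
  subtracted from every \<open>v j\<close>. The diagonal term then vanishes and the others are
  products of nonnegative numbers.\<close>

lemma metzler_sum_nonneg:
  assumes \<pi>: "\<pi> \<in> metzler_set N" and i: "i \<in> {1..N}" and v: "\<And>j. j \<in> {1..N} \<Longrightarrow> v i \<le> v j"
  shows "(\<Sum>j\<in>{1..N}. \<pi> j i * v j) \<ge> 0"
proof -
  have "0 = (\<Sum>j\<in>{1..N}. \<pi> j i) * v i"
    using \<pi> i by (simp add: metzler_set_def)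
  also have "\<dots> = (\<Sum>j\<in>{1..N}. \<pi> j i * v i)"
    by (simp add: sum_distrib_right)
  also have "\<dots> \<le> (\<Sum>j\<in>{1..N}. \<pi> j i * v j)"
  proof (rule sum_mono)
    fix j assume j: "j \<in> {1..N}"
    show "\<pi> j i * v i \<le> \<pi> j i * v j"
    proof (cases "j = i")
      case False
      then have "\<pi> j i \<ge> 0" using \<pi> i j by (simp add: metzler_set_def)
      then show ?thesis using v[OF j] by (rule mult_left_mono[rotated])
    qed simp
  qed
  finally show ?thesis .
qed

lemma min_value_lipschitz:
  assumes "N \<ge> 1"
  shows "\<exists>L>0. \<forall>x y. \<bar>min_value N P x - min_value N P y\<bar> \<le> L * (norm x + norm y) * norm (x - y)"
proof -
  have "\<exists>B>0. \<forall>x y. \<bar>x \<bullet> (P i *v x) - y \<bullet> (P i *v y)\<bar> \<le> B * (norm x + norm y) * norm (x - y)" for i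
    by (rule quadratic_form_diff_bound)
  then obtain B where B: "\<And>i. B i > 0"
    "\<And>i x y. \<bar>x \<bullet> (P i *v x) - y \<bullet> (P i *v y)\<bar> \<le> B i * (norm x + norm y) * norm (x - y)"
    by metis
  define L where "L = (\<Sum>i\<in>{1..N}. B i)"
  have BL: "B i \<le> L" if "i \<in> {1..N}" for i
    unfolding L_def using that B(1) by (intro member_le_sum) (auto simp: less_imp_le)
  have L: "L > 0" using BL[of 1] B(1)[of 1] assms by auto
  have le: "min_value N P x - min_value N P y \<le> L * (norm x + norm y) * norm (x - y)" for x y
  proof -
    \<comment> \<open>The minimiser at \<open>y\<close> gives the exact value at \<open>y\<close>
      and an upper bound at \<open>x\<close>. Exchanging the two points yields the other half of the
      absolute value.\<close>
    let ?i = "min_switching N P y"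
    note i = min_switching_arg_min[OF assms, where P=P and x=y]
    have "min_value N P x - min_value N P y \<le> x \<bullet> (P ?i *v x) - y \<bullet> (P ?i *v y)"
      using min_value_le[OF i(1), where P=P and x=x] i(2) by simp
    also have "\<dots> \<le> B ?i * (norm x + norm y) * norm (x - y)"
      using B(2)[of x ?i y] by simp
    also have "\<dots> \<le> L * (norm x + norm y) * norm (x - y)"
      using BL[OF i(1)] by (intro mult_right_mono) auto
    finally show ?thesis .
  qed
  have "\<bar>min_value N P x - min_value N P y\<bar> \<le> L * (norm x + norm y) * norm (x - y)" for x y
    using le[of x y] le[of y x] by (simp add: abs_le_iff norm_minus_commute add.commute)
  with L show ?thesis by blast
qed

section \<open>Absolute continuity: continuity and Lipschitz composition\<close>

lemma abs_continuous_on_imp_continuous_on: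
  assumes "abs_continuous_on {a..b} f"
  shows "continuous_on {a..b} f"
  unfolding continuous_on_iff
proof (intro ballI allI impI)
  fix s e :: real assume s: "s \<in> {a..b}" and "e > 0"
  then obtain \<delta> where \<delta>: "\<delta> > 0"
    "\<And>D. D division_of \<Union>D \<Longrightarrow> \<Union>D \<subseteq> {a..b} \<Longrightarrow> (\<Sum>K\<in>D. Sup K - Inf K) < \<delta> \<Longrightarrow>
       (\<Sum>K\<in>D. norm (f (Sup K) - f (Inf K))) < e"
    using assms unfolding abs_continuous_on_def by meson
  have *: "norm (f v - f u) < e" if "u \<in> {a..b}" "v \<in> {a..b}" "u \<le> v" "v - u < \<delta>" for u v
    using \<delta>(2)[of "{{u..v}}"] that division_of_self[of u v] by auto
  have "dist (f t) (f s) < e" if "t \<in> {a..b}" "dist t s < \<delta>" for t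
    using *[of s t] *[of t s] s that
    by (cases "s \<le> t") (auto simp: dist_norm norm_minus_commute)
  with \<delta>(1) show "\<exists>d>0. \<forall>t\<in>{a..b}. dist t s < d \<longrightarrow> dist (f t) (f s) < e"
    by blast
qed

text \<open>The Lipschitz condition is imposed only on values taken by \<open>f\<close>, because the
  minimum of quadratic forms is Lipschitz only on bounded sets.\<close>

lemma abs_continuous_on_lipschitz_compose:
  fixes f :: "real \<Rightarrow> 'a::real_normed_vector" and h :: "'a \<Rightarrow> 'b::real_normed_vector"
  assumes f: "abs_continuous_on S f" and "L > 0"
    and h: "\<And>s t. s \<in> S \<Longrightarrow> t \<in> S \<Longrightarrow> norm (h (f s) - h (f t)) \<le> L * norm (f s - f t)"
  shows "abs_continuous_on S (\<lambda>t. h (f t))"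
  unfolding abs_continuous_on_def
proof (intro allI impI)
  fix e :: real assume "e > 0"
  then have "e / L > 0" using \<open>L > 0\<close> by simp
  then obtain \<delta> where \<delta>: "\<delta> > 0"
    "\<And>D. D division_of \<Union>D \<Longrightarrow> \<Union>D \<subseteq> S \<Longrightarrow> (\<Sum>K\<in>D. Sup K - Inf K) < \<delta> \<Longrightarrow>
       (\<Sum>K\<in>D. norm (f (Sup K) - f (Inf K))) < e / L"
    using f unfolding abs_continuous_on_def by meson
  have "(\<Sum>K\<in>D. norm (h (f (Sup K)) - h (f (Inf K)))) < e"
    if D: "D division_of \<Union>D" "\<Union>D \<subseteq> S" "(\<Sum>K\<in>D. Sup K - Inf K) < \<delta>" for D
  proof -
    have "(\<Sum>K\<in>D. norm (h (f (Sup K)) - h (f (Inf K)))) \<le> (\<Sum>K\<in>D. L * norm (f (Sup K) - f (Inf K)))"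
    proof (intro sum_mono h)
      fix K assume K: "K \<in> D"
      then obtain u v where "K = {u..v}" "u \<le> v"
        using division_ofD(3,4)[OF D(1) K] by (metis atLeastatMost_empty_iff2 box_real(2))
      moreover have "K \<subseteq> S" using K D(2) by blast
      ultimately show "Sup K \<in> S" "Inf K \<in> S" by auto
    qed
    also have "\<dots> = L * (\<Sum>K\<in>D. norm (f (Sup K) - f (Inf K)))"
      by (simp add: sum_distrib_left)
    also have "\<dots> < L * (e / L)"
      using \<delta>(2)[OF D] \<open>L > 0\<close> by (intro mult_strict_left_mono)
    finally show ?thesis using \<open>L > 0\<close> by simp
  qed
  with \<delta>(1) show "\<exists>\<delta>>0. \<forall>D. D division_of \<Union> D \<longrightarrow> \<Union> D \<subseteq> S \<longrightarrow> (\<Sum>K\<in>D. Sup K - Inf K) < \<delta> \<longrightarrow>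
       (\<Sum>K\<in>D. norm (h (f (Sup K)) - h (f (Inf K)))) < e"
    by blast
qed

subsection \<open>Dissipation along closed-loop solutions\<close>

lemma abs_continuous_on_subset:
  assumes "abs_continuous_on S f" "T \<subseteq> S"
  shows "abs_continuous_on T f"
  using assms unfolding abs_continuous_on_def by (meson subset_trans)

text \<open>This passes from a pointwise bound on the weighted mode derivatives to an integrated
  bound on V. The inequality in the solution concept is what links the derivative of the selected
  form along the actual velocity to the weighted sum over the active modes.\<close>

lemma closed_loop_min_value_bound:
  assumes N: "N \<ge> 1"
    and sol: "closed_loop_solution N A E P (min_switching N P) \<psi> x a"
    and sT: "0 \<le> s" "s \<le> T"
    and g: "g absolutely_integrable_on {s..T}"
    and le: "\<And>t. t \<in> {s..T} \<Longrightarrow> (\<Sum>i\<in>active N (min_switching N P) (x t).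
                a i t * vdot (P i) (x t) (vfield A E \<psi> i (x t) t)) \<le> g t"
  shows "min_value N P (x T) - min_value N P (x s) \<le> integral {s..T} g"
proof -
  let ?\<sigma> = "min_switching N P"
  let ?v = "\<lambda>t. \<Sum>i\<in>active N ?\<sigma> (x t). a i t *\<^sub>R vfield A E \<psi> i (x t) t"
  have acx: "abs_continuous_on {s..T} x"
  proof (rule abs_continuous_on_subset)
    show "abs_continuous_on {0..T} x"
      using sol sT by (simp add: closed_loop_solution_def)
  qed (use sT in auto)
  \<comment> \<open>On a compact time interval the trajectory stays in a ball, where the local
    Lipschitz bound on V becomes uniform; hence V along the solution is absolutely
    continuous.\<close>
  obtain R where R: "R > 0" "\<And>t. t \<in> {s..T} \<Longrightarrow> norm (x t) \<le> R"
    using compact_imp_bounded[OF compact_continuous_image[OF abs_continuous_on_imp_continuous_on[OF acx] compact_Icc]]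
    unfolding bounded_pos by blast
  obtain L where L: "L > 0"
    "\<And>x y. \<bar>min_value N P x - min_value N P y\<bar> \<le> L * (norm x + norm y) * norm (x - y)"
    using min_value_lipschitz[OF N] by blast
  have acV: "abs_continuous_on {s..T} (\<lambda>t. min_value N P (x t))"
  proof (rule abs_continuous_on_lipschitz_compose[OF acx])
    show "L * (R + R) > 0" using L R by simp
    fix t u assume tu: "t \<in> {s..T}" "u \<in> {s..T}"
    have "L * (norm (x t) + norm (x u)) * norm (x t - x u) \<le> L * (R + R) * norm (x t - x u)"
      using R(2)[OF tu(1)] R(2)[OF tu(2)] L(1)
      by (intro mult_right_mono mult_left_mono add_mono) auto
    then show "norm (min_value N P (x t) - min_value N P (x u)) \<le> L * (R + R) * norm (x t - x u)"
      using L(2)[of "x t" "x u"] by simp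
  qed
  define Q where "Q = (\<lambda>t. (x has_vector_derivative ?v t) (at t within {0..}) \<and>
      vdot (P (?\<sigma> (x t))) (x t) (?v t) \<le> (\<Sum>i\<in>active N ?\<sigma> (x t). a i t * vdot (P i) (x t) (vfield A E \<psi> i (x t) t)))"
  have "AE t in lebesgue_on {0..}. Q t"
    using sol unfolding closed_loop_solution_def Q_def vdot_scaleR by blast
  then have "AE t in lebesgue. t \<in> {0..} \<longrightarrow> Q t"
    by (simp add: AE_restrict_space_iff)
  then obtain Z where Z: "Z \<in> null_sets lebesgue" and D: "\<And>t. t \<ge> 0 \<Longrightarrow> t \<notin> Z \<Longrightarrow> Q t"
    unfolding eventually_ae_filter by auto
  show ?thesis
  proof (rule ac_right_derivative_bound[OF sT(2) acV g])
    show "negligible Z" using Z by (simp add: negligible_iff_null_sets)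
    fix t e :: real assume t: "s \<le> t" "t < T" "t \<notin> Z" and "e > 0"
    \<comment> \<open>The mode is frozen at time \<open>t\<close>. Its form is differentiable along
      the solution, equals V at time \<open>t\<close> and dominates V at all other times, so its
      difference quotients to the right bound those of V.\<close>
    define i where "i = ?\<sigma> (x t)"
    let ?q = "\<lambda>u. x u \<bullet> (P i *v x u)" and ?D = "vdot (P i) (x t) (?v t)"
    have "t \<ge> 0" using t sT by simp
    note Dt = D[OF this t(3), unfolded Q_def]
    have "(?q has_real_derivative ?D) (at t within {0..})"
      using Dt by (intro quadratic_form_has_derivative) blast
    then have "((\<lambda>u. (?q u - ?q t) / (u - t)) \<longlongrightarrow> ?D) (at t within {0..})"
      by (simp add: has_field_derivative_iff)
    then have "\<forall>\<^sub>F u in at t within {0..}. (?q u - ?q t) / (u - t) < ?D + e"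
      using \<open>e > 0\<close> by (intro order_tendstoD) auto
    then obtain d where d: "d > 0" "\<And>u. u \<ge> 0 \<Longrightarrow> u \<noteq> t \<Longrightarrow> dist u t < d \<Longrightarrow> (?q u - ?q t) / (u - t) < ?D + e"
      unfolding eventually_at by auto
    have "min_value N P (x u) - min_value N P (x t) \<le> (g t + e) * (u - t)"
      if u: "t < u" "u < t + d" for u
    proof -
      have "(?q u - ?q t) / (u - t) < ?D + e"
        using u \<open>t \<ge> 0\<close> by (intro d(2)) (auto simp: dist_real_def)
      also have "?D + e \<le> g t + e"
        using Dt le[of t] t by (simp add: i_def)
      finally have "?q u - ?q t \<le> (g t + e) * (u - t)"
        using u by (simp add: divide_simps)
      moreover have "min_value N P (x u) \<le> ?q u" "min_value N P (x t) = ?q t"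
        using min_switching_arg_min[OF N, where P=P and x="x t"] min_value_le by (auto simp: i_def)
      ultimately show ?thesis by simp
    qed
    with d(1) show "\<exists>d>0. \<forall>u. t < u \<and> u < t + d \<and> u \<le> T \<longrightarrow>
        min_value N P (x u) - min_value N P (x t) \<le> (g t + e) * (u - t)"
      by blast
  qed
qed

text \<open>The weighted variance of the \<open>z i\<close> about their mean \<open>m\<close> is
  nonnegative; expanding it gives Jensen's inequality for the squared norm.\<close>

lemma norm_convex_combination_sq_le:
  fixes z :: "'i \<Rightarrow> 'a::real_inner"
  assumes w: "\<And>i. i \<in> I \<Longrightarrow> w i \<ge> 0" "(\<Sum>i\<in>I. w i) = 1"
  shows "(norm (\<Sum>i\<in>I. w i *\<^sub>R z i))\<^sup>2 \<le> (\<Sum>i\<in>I. w i * (norm (z i))\<^sup>2)"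
proof -
  define m where "m = (\<Sum>i\<in>I. w i *\<^sub>R z i)"
  have "0 \<le> (\<Sum>i\<in>I. w i * (norm (z i - m))\<^sup>2)"
    using w by (intro sum_nonneg) auto
  also have "\<dots> = (\<Sum>i\<in>I. w i * (norm (z i))\<^sup>2 - 2 * ((w i *\<^sub>R z i) \<bullet> m) + w i * (m \<bullet> m))"
    by (intro sum.cong refl)
       (simp add: power2_norm_eq_inner inner_simps algebra_simps inner_commute)
  also have "\<dots> = (\<Sum>i\<in>I. w i * (norm (z i))\<^sup>2) - 2 * (m \<bullet> m) + (m \<bullet> m)"
    using w(2) by (simp add: sum.distrib sum_subtractf m_def inner_sum_left flip: sum_distrib_left sum_distrib_right)
  finally show ?thesis by (simp add: m_def power2_norm_eq_inner)
qed

lemma switched_dissipation: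
  assumes N: "N \<ge> 1" and \<pi>: "\<pi> \<in> metzler_set N"
    and lmi: "\<And>i. i \<in> {1..N} \<Longrightarrow>
       vdot (P i) x (A i *v x + E i *v y) + x \<bullet> ((\<Sum>j\<in>{1..N}. \<pi> j i *\<^sub>R P j) *v x)
         + (norm (C i *v x + F i *v y))\<^sup>2 \<le> r"
    and w: "\<And>i. i \<in> active N (min_switching N P) x \<Longrightarrow> w i \<ge> 0"
      "(\<Sum>i\<in>active N (min_switching N P) x. w i) = 1"
  shows "(\<Sum>i\<in>active N (min_switching N P) x. w i * vdot (P i) x (A i *v x + E i *v y)) \<le>
           r - (norm (\<Sum>i\<in>active N (min_switching N P) x. w i *\<^sub>R (C i *v x + F i *v y)))\<^sup>2"
proof -
  let ?I = "active N (min_switching N P) x" and ?z = "\<lambda>i. C i *v x + F i *v y"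
  have "w i * vdot (P i) x (A i *v x + E i *v y) \<le> w i * r - w i * (norm (?z i))\<^sup>2"
    if i: "i \<in> ?I" for i
  proof -
    have iN: "i \<in> {1..N}" using active_subset i by blast
    have "x \<bullet> ((\<Sum>j\<in>{1..N}. \<pi> j i *\<^sub>R P j) *v x) = (\<Sum>j\<in>{1..N}. \<pi> j i * (x \<bullet> (P j *v x)))"
      by (simp add: matrix_vector_mult_sum_scaleR inner_sum_right)
    also have "\<dots> \<ge> 0"
      using active_min_switching_value[OF N i] min_value_le[where P=P and x=x]
      by (intro metzler_sum_nonneg[OF \<pi> iN]) auto
    finally have "vdot (P i) x (A i *v x + E i *v y) \<le> r - (norm (?z i))\<^sup>2"
      using lmi[OF iN] by linarith
    from mult_left_mono[OF this w(1)[OF i]] show ?thesis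
      by (simp add: right_diff_distrib)
  qed
  then have "(\<Sum>i\<in>?I. w i * vdot (P i) x (A i *v x + E i *v y))
      \<le> (\<Sum>i\<in>?I. w i * r - w i * (norm (?z i))\<^sup>2)"
    by (rule sum_mono)
  also have "\<dots> = r - (\<Sum>i\<in>?I. w i * (norm (?z i))\<^sup>2)"
    using w(2) by (simp add: sum_subtractf flip: sum_distrib_right)
  also have "\<dots> \<le> r - (norm (\<Sum>i\<in>?I. w i *\<^sub>R ?z i))\<^sup>2"
    using norm_convex_combination_sq_le[of ?I w ?z, OF w] by simp
  finally show ?thesis .
qed

text \<open>Taking the minimum of finitely many positive margins is legitimate because
  \<open>Q\<close> is inherited by smaller positive constants.\<close>

lemma finite_uniform_positive:
  fixes Q :: "'i \<Rightarrow> real \<Rightarrow> bool"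
  assumes "finite S" "\<And>i. i \<in> S \<Longrightarrow> \<exists>c>0. Q i c"
    and mono: "\<And>i c c'. Q i c \<Longrightarrow> 0 < c' \<Longrightarrow> c' \<le> c \<Longrightarrow> Q i c'"
  shows "\<exists>c>0. \<forall>i\<in>S. Q i c"
  using assms(1,2)
proof (induction S rule: finite_induct)
  case empty
  show ?case by (intro exI[of _ 1]) simp
next
  case (insert j S)
  then obtain c where "c > 0" "\<forall>i\<in>S. Q i c" by auto
  moreover obtain d where "d > 0" "Q j d" using insert.prems by auto
  ultimately show ?case
    by (intro exI[of _ "min c d"]) (auto intro: mono[of _ c] mono[of _ d])
qed

section \<open>Growth of the minimum function and asymptotic stability\<close>

lemma min_value_zero [simp]: "N \<ge> 1 \<Longrightarrow> min_value N P 0 = 0"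
  using min_switching_arg_min(2)[of N 0 P] by simp

lemma min_value_lower_bound:
  assumes "N \<ge> 1" "\<forall>i\<in>{1..N}. pos_definite (P i)"
  shows "\<exists>\<alpha>>0. \<forall>x. \<alpha> * (x \<bullet> x) \<le> min_value N P x"
proof -
  have "\<exists>\<alpha>>0. \<forall>i\<in>{1..N}. \<forall>x. \<alpha> * (x \<bullet> x) \<le> x \<bullet> (P i *v x)"
  proof (rule finite_uniform_positive)
    show "\<exists>c>0. \<forall>x. c * (x \<bullet> x) \<le> x \<bullet> (P i *v x)" if "i \<in> {1..N}" for i
      using assms(2) that by (intro quadratic_form_coercive) (auto simp: pos_definite_def)
    show "\<forall>x. c' * (x \<bullet> x) \<le> x \<bullet> (P i *v x)"
      if "\<forall>x. c * (x \<bullet> x) \<le> x \<bullet> (P i *v x)" "c' \<le> c" for i c c'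
      using that by (meson inner_ge_zero mult_right_mono order_trans)
  qed simp
  then show ?thesis
    using min_switching_arg_min[OF assms(1), where P=P] by metis
qed

lemma min_value_upper_bound:
  assumes "N \<ge> 1"
  shows "\<exists>\<beta>>0. \<forall>x. min_value N P x \<le> \<beta> * (x \<bullet> x)"
proof -
  obtain L where L: "L > 0"
    "\<And>x y. \<bar>min_value N P x - min_value N P y\<bar> \<le> L * (norm x + norm y) * norm (x - y)"
    using min_value_lipschitz[OF assms] by blast
  have "min_value N P x \<le> L * (x \<bullet> x)" for x
    using L(2)[of x 0] assms by (simp add: dot_square_norm power2_eq_square mult.assoc)
  with L(1) show ?thesis by blast
qed

lemma continuous_on_min_value:
  assumes "N \<ge> 1"
  shows "continuous_on S (min_value N P)"
proof -
  have "continuous_on S (\<lambda>x. Min ((\<lambda>i. x \<bullet> (P i *v x)) ` I))" if "finite I" "I \<noteq> {}" for I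
    using that
  proof (induction I rule: finite_ne_induct)
    case (insert i I)
    then show ?case
      by (simp add: continuous_on_min continuous_on_quadratic_form)
  qed (simp add: continuous_on_quadratic_form)
  from this[of "{1..N}"] assms show ?thesis
    by (simp add: min_value_def[abs_def])
qed

lemma solution_continuous_on:
  assumes "closed_loop_solution N A E P \<sigma> \<psi> x a"
  shows "continuous_on {0..} x"
  unfolding continuous_on_eq_continuous_within
proof
  fix t :: real assume t: "t \<in> {0..}"
  \<comment> \<open>Absolute continuity is given on compact intervals only; the extra unit makes the
    interval a neighbourhood of \<open>t\<close> relative to the half-line.\<close>
  have "continuous_on {0..t+1} x"
    using assms t by (auto simp: closed_loop_solution_def intro!: abs_continuous_on_imp_continuous_on)
  then have "continuous (at t within {0..t+1}) x"
    using t by (auto simp: continuous_on_eq_continuous_within)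
  moreover have "at t within {0..t+1} = at t within {0..}"
    by (rule at_within_nhd[of _ "{..<t+1}"]) auto
  ultimately show "continuous (at t within {0..}) x" by simp
qed

text \<open>V lies between \<alpha> |x|^2 and \<beta> |x|^2 and satisfies an integrated form of V'
  \<le> -k V. Monotonicity of V then yields decay like 1 / (1 + k T), which suffices for convergence
  and avoids a Gronwall argument.\<close>

lemma origin_GAS_min_switching:
  assumes N: "N \<ge> 1" and P: "\<forall>i\<in>{1..N}. pos_definite (P i)" and "c > 0"
    and decay: "\<And>x w. (\<And>i. i \<in> active N (min_switching N P) x \<Longrightarrow> w i \<ge> 0) \<Longrightarrow>
        (\<Sum>i\<in>active N (min_switching N P) x. w i) = 1 \<Longrightarrow>
        (\<Sum>i\<in>active N (min_switching N P) x. w i * vdot (P i) x (A i *v x)) \<le> - c * (x \<bullet> x)"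
  shows "origin_GAS N A E P (min_switching N P)"
proof -
  let ?V = "min_value N P"
  obtain \<alpha> where \<alpha>: "\<alpha> > 0" "\<And>x. \<alpha> * (x \<bullet> x) \<le> ?V x"
    using min_value_lower_bound[OF N P] by blast
  obtain \<beta> where \<beta>: "\<beta> > 0" "\<And>x. ?V x \<le> \<beta> * (x \<bullet> x)"
    using min_value_upper_bound[OF N] by blast
  \<comment> \<open>As V \<le> \<beta> |x|^2, the decay -c |x|^2 is at most -k V.\<close>
  define k where "k = c / \<beta>"
  have k: "k > 0" using \<beta> \<open>c > 0\<close> by (simp add: k_def)
  have V0: "?V x \<ge> 0" for x
    using \<alpha>(1) by (intro order_trans[OF _ \<alpha>(2)]) simp
  have kV: "- c * (x \<bullet> x) \<le> - k * ?V x" for x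
  proof -
    have "k * ?V x \<le> k * (\<beta> * (x \<bullet> x))"
      using k \<beta>(2) by (intro mult_left_mono) auto
    then show ?thesis using \<beta>(1) by (simp add: k_def)
  qed
  have main: "?V (x T) - ?V (x s) \<le> - (k * integral {s..T} (\<lambda>t. ?V (x t)))"
     and Vint: "(\<lambda>t. ?V (x t)) integrable_on {s..T}"
    if sol: "closed_loop_solution N A E P (min_switching N P) (\<lambda>_. 0) x a" and sT: "0 \<le> s" "s \<le> T" for x a s T
  proof -
    have cV: "continuous_on {s..T} (\<lambda>t. ?V (x t))"
      using sT by (intro continuous_on_compose2[OF continuous_on_min_value[OF N, of UNIV]]
            continuous_on_subset[OF solution_continuous_on[OF sol]]) auto
    then show "(\<lambda>t. ?V (x t)) integrable_on {s..T}"
      by (rule integrable_continuous_real)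
    have "?V (x T) - ?V (x s) \<le> integral {s..T} (\<lambda>t. - k * ?V (x t))"
    proof (rule closed_loop_min_value_bound[OF N sol sT])
      show "(\<lambda>t. - k * ?V (x t)) absolutely_integrable_on {s..T}"
        using cV by (intro absolutely_integrable_continuous_real continuous_intros)
      fix t assume "t \<in> {s..T}"
      then have "t \<ge> 0" using sT by simp
      then have "(\<Sum>i\<in>active N (min_switching N P) (x t). a i t * vdot (P i) (x t) (A i *v x t)) \<le> - c * (x t \<bullet> x t)"
        using sol by (intro decay) (auto simp: closed_loop_solution_def)
      then show "(\<Sum>i\<in>active N (min_switching N P) (x t). a i t * vdot (P i) (x t) (vfield A E (\<lambda>_. 0) i (x t) t)) \<le> - k * ?V (x t)"
        using kV[of "x t"] by (simp add: vfield_def)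
    qed
    then show "?V (x T) - ?V (x s) \<le> - (k * integral {s..T} (\<lambda>t. ?V (x t)))" by simp
  qed
  have mono: "?V (x T) \<le> ?V (x s)"
    if sol: "closed_loop_solution N A E P (min_switching N P) (\<lambda>_. 0) x a" and sT: "0 \<le> s" "s \<le> T" for x a s T
  proof -
    have "integral {s..T} (\<lambda>t. ?V (x t)) \<ge> 0"
      using Vint[OF that] V0 by (intro integral_nonneg) auto
    then have "k * integral {s..T} (\<lambda>t. ?V (x t)) \<ge> 0"
      using k by simp
    then show ?thesis using main[OF that] by linarith
  qed
  \<comment> \<open>V is nonincreasing along the solution, so its integral over [0, T] is at least T
    times its final value.\<close>
  have decayV: "?V (x T) * (1 + k * T) \<le> ?V (x 0)"
    if sol: "closed_loop_solution N A E P (min_switching N P) (\<lambda>_. 0) x a" and T: "0 \<le> T" for x a T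
  proof -
    have "integral {0..T} (\<lambda>t. ?V (x T)) \<le> integral {0..T} (\<lambda>t. ?V (x t))"
      using Vint[OF sol order_refl T] mono[OF sol] by (intro integral_le) auto
    then have "k * (T * ?V (x T)) \<le> k * integral {0..T} (\<lambda>t. ?V (x t))"
      using k T by (intro mult_left_mono) auto
    then show ?thesis using main[OF sol order_refl T] by (simp add: algebra_simps)
  qed
  show ?thesis
    unfolding origin_GAS_def
  proof (intro conjI allI impI)
    fix \<epsilon> :: real assume \<epsilon>: "\<epsilon> > 0"
    \<comment> \<open>Chosen so that \<beta> \<delta>^2 = \<alpha> \<epsilon>^2.\<close>
    define \<delta> where "\<delta> = \<epsilon> * sqrt (\<alpha> / \<beta>)"
    have "norm (x t) < \<epsilon>"
      if sol: "closed_loop_solution N A E P (min_switching N P) (\<lambda>_. 0) x a" and x0: "norm (x 0) < \<delta>" and t: "t \<ge> 0" for x a t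
    proof -
      have "\<alpha> * (norm (x t))\<^sup>2 \<le> \<beta> * (norm (x 0))\<^sup>2"
        using \<alpha>(2)[of "x t"] \<beta>(2)[of "x 0"] mono[OF sol order_refl t] by (simp add: dot_square_norm)
      also have "\<dots> < \<beta> * \<delta>\<^sup>2"
        using \<beta>(1) x0 by (intro mult_strict_left_mono power_strict_mono) auto
      also have "\<dots> = \<alpha> * \<epsilon>\<^sup>2"
        using \<alpha>(1) \<beta>(1) by (simp add: \<delta>_def power_mult_distrib)
      finally have "(norm (x t))\<^sup>2 < \<epsilon>\<^sup>2" using \<alpha>(1) by simp
      then show ?thesis using \<epsilon> by (simp add: power_less_imp_less_base)
    qed
    moreover have "\<delta> > 0" using \<epsilon> \<alpha> \<beta> by (simp add: \<delta>_def)
    ultimately show "\<exists>\<delta>>0. \<forall>x a. closed_loop_solution N A E P (min_switching N P) (\<lambda>_. 0) x a \<longrightarrow> norm (x 0) < \<delta> \<longrightarrow>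
        (\<forall>t\<ge>0. norm (x t) < \<epsilon>)" by blast
  next
    fix x a assume sol: "closed_loop_solution N A E P (min_switching N P) (\<lambda>_. 0) x a"
    have "((\<lambda>t. (norm (x t))\<^sup>2) \<longlongrightarrow> 0) at_top"
    proof (rule tendsto_sandwich[where f="\<lambda>_. 0"])
      show "\<forall>\<^sub>F t in at_top. (norm (x t))\<^sup>2 \<le> ?V (x 0) / \<alpha> / (1 + k * t)"
      proof (rule eventually_mono[OF eventually_ge_at_top[of 0]])
        fix t :: real assume t: "t \<ge> 0"
        have p: "1 + k * t > 0" using k t by (simp add: add_pos_nonneg)
        have "\<alpha> * (norm (x t))\<^sup>2 * (1 + k * t) \<le> ?V (x t) * (1 + k * t)"
          using \<alpha>(2)[of "x t"] p by (intro mult_right_mono) (auto simp: dot_square_norm)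
        also have "\<dots> \<le> ?V (x 0)" by (rule decayV[OF sol t])
        finally show "(norm (x t))\<^sup>2 \<le> ?V (x 0) / \<alpha> / (1 + k * t)"
          using p \<alpha>(1) by (simp add: pos_le_divide_eq mult_ac)
      qed
      have "filterlim (\<lambda>t. 1 + k * t) at_top at_top"
        by (intro filterlim_tendsto_add_at_top[OF tendsto_const]
            filterlim_tendsto_pos_mult_at_top[OF tendsto_const k filterlim_ident])
      then show "((\<lambda>t. ?V (x 0) / \<alpha> / (1 + k * t)) \<longlongrightarrow> 0) at_top"
        by (intro tendsto_divide_0[OF tendsto_const] filterlim_at_top_imp_at_infinity)
    qed auto
    then have "((\<lambda>t. sqrt ((norm (x t))\<^sup>2)) \<longlongrightarrow> sqrt 0) at_top"
      by (rule tendsto_real_sqrt)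
    then show "(x \<longlongrightarrow> 0) at_top"
      by (simp add: tendsto_norm_zero_iff)
  qed
qed

subsection \<open>The induced gain\<close>

lemma borel_measurable_matrix_vector_mult:
  fixes M :: "real^'n^'m"
  assumes "f \<in> borel_measurable X"
  shows "(\<lambda>t. M *v f t) \<in> borel_measurable X"
  using measurable_compose[OF assms
      borel_measurable_continuous_onI[OF linear_continuous_on[OF matrix_vector_mul_bounded_linear]]] .

text \<open>A weight is measurable only on the times at which its mode is active. These times form a
  closed set, the preimage of a closure under the continuous trajectory, so extension by zero is
  measurable and the sum can run over the fixed index set {1..N}.\<close>

lemma borel_measurable_modified_output:
  assumes sol: "closed_loop_solution N A E P \<sigma> \<psi> x a"
    and \<psi>: "\<psi> \<in> borel_measurable (lebesgue_on {0..})"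
  shows "modified_output N C F \<sigma> \<psi> x a \<in> borel_measurable (lebesgue_on {0..})"
proof -
  define S where "S = (\<lambda>i. {t. t \<ge> 0 \<and> i \<in> active N \<sigma> (x t)})"
  define b where "b = (\<lambda>i t. if t \<in> S i then a i t else 0)"
  note x = solution_continuous_on[OF sol]
  have b: "b i \<in> borel_measurable (lebesgue_on {0..})" if i: "i \<in> {1..N}" for i
  proof -
    have "S i = {0..} \<inter> x -` closure (region \<sigma> i)"
      using i by (auto simp: S_def active_iff_closure)
    then have "closed (S i)"
      using continuous_closed_preimage[OF x] by simp
    then have "S i \<in> sets lebesgue" by (simp add: borel_closed)
    moreover have "a i \<in> borel_measurable (lebesgue_on (S i))"
      using sol i by (simp add: closed_loop_solution_def S_def)
    ultimately have "b i \<in> borel_measurable lebesgue"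
      unfolding b_def by (intro borel_measurable_if_I)
    then show ?thesis by (rule measurable_restrict_space1)
  qed
  have xm: "x \<in> borel_measurable (lebesgue_on {0..})"
    by (rule continuous_imp_measurable_on_sets_lebesgue[OF x]) simp
  have "(\<lambda>t. \<Sum>i\<in>{1..N}. b i t *\<^sub>R (C i *v x t + F i *v \<psi> t)) \<in> borel_measurable (lebesgue_on {0..})"
    by (intro borel_measurable_sum borel_measurable_scaleR borel_measurable_add
        borel_measurable_matrix_vector_mult xm \<psi> b)
  moreover have "modified_output N C F \<sigma> \<psi> x a t = (\<Sum>i\<in>{1..N}. b i t *\<^sub>R (C i *v x t + F i *v \<psi> t))"
    if "t \<in> space (lebesgue_on {0..})" for t
    unfolding modified_output_def using that active_subset
    by (intro sum.mono_neutral_cong_left) (auto simp: b_def S_def)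
  ultimately show ?thesis by (subst measurable_cong)
qed

lemma affine_output_bound:
  fixes C :: "nat \<Rightarrow> real^'n^'p" and F :: "nat \<Rightarrow> real^'q^'p"
  assumes "finite I"
  shows "\<exists>K>0. \<forall>i\<in>I. \<forall>x y. norm (C i *v x + F i *v y) \<le> K * (norm x + norm y)"
proof -
  have "\<exists>K>0. \<forall>x y. norm (C i *v x + F i *v y) \<le> K * (norm x + norm y)" for i
  proof -
    obtain B where B: "B > 0" "\<And>x. norm (C i *v x) \<le> norm x * B"
      using bounded_linear.pos_bounded[OF matrix_vector_mul_bounded_linear] by blast
    obtain D where D: "D > 0" "\<And>x. norm (F i *v x) \<le> norm x * D"
      using bounded_linear.pos_bounded[OF matrix_vector_mul_bounded_linear] by blast
    have "norm (C i *v x + F i *v y) \<le> (B + D) * (norm x + norm y)" for x y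
    proof -
      have "norm (C i *v x + F i *v y) \<le> norm x * B + norm y * D"
        by (rule norm_triangle_le) (use B(2) D(2) in \<open>intro add_mono\<close>)
      also have "\<dots> \<le> (B + D) * (norm x + norm y)"
        using B(1) D(1) by (simp add: algebra_simps)
      finally show ?thesis .
    qed
    moreover have "B + D > 0" using B D by simp
    ultimately show ?thesis by blast
  qed
  then obtain K where K: "\<And>i. K i > 0" "\<And>i x y. norm (C i *v x + F i *v y) \<le> K i * (norm x + norm y)"
    by metis
  \<comment> \<open>The summand 1 keeps the constant positive even for empty
    \<open>I\<close>.\<close>
  have "norm (C i *v x + F i *v y) \<le> (1 + sum K I) * (norm x + norm y)" if "i \<in> I" for i x y
  proof -
    have "K i \<le> 1 + sum K I"
      using member_le_sum[OF that, of K] K(1) assms by (simp add: less_imp_le add_increasing)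
    then show ?thesis
      using K(2)[of i x y] by (meson add_nonneg_nonneg mult_right_mono norm_ge_zero order_trans)
  qed
  moreover have "1 + sum K I > 0"
    using K(1) by (intro add_pos_nonneg sum_nonneg) (auto simp: less_imp_le)
  ultimately show ?thesis by blast
qed

lemma nn_integral_eq_integral_on:
  fixes h :: "'a::euclidean_space \<Rightarrow> real"
  assumes h: "h absolutely_integrable_on S" and h0: "\<And>t. h t \<ge> 0"
  shows "(\<integral>\<^sup>+ t. ennreal (h t) * indicator S t \<partial>lebesgue) = ennreal (integral S h)"
proof -
  have "(\<integral>\<^sup>+ t. ennreal (h t) * indicator S t \<partial>lebesgue) = (\<integral>\<^sup>+ t. ennreal (indicator S t *\<^sub>R h t) \<partial>lebesgue)"
    by (intro nn_integral_cong) (auto simp: indicator_def)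
  also have "\<dots> = ennreal (LINT t|lebesgue. indicator S t *\<^sub>R h t)"
    using h h0 by (intro nn_integral_eq_integral) (auto simp: set_integrable_def)
  also have "(LINT t|lebesgue. indicator S t *\<^sub>R h t) = integral S h"
    using set_lebesgue_integral_eq_integral(2)[OF h] by (simp add: set_lebesgue_integral_def)
  finally show ?thesis .
qed

text \<open>Monotone convergence over the horizons [0, n]. It lets the gain estimate be proved on
  finite horizons, with no prior knowledge that the output has finite norm.\<close>

lemma l2_norm_sq_eq_SUP:
  assumes s: "s \<in> borel_measurable (lebesgue_on {0..})"
  shows "l2_norm_sq s = (SUP n::nat. \<integral>\<^sup>+ t. ennreal (s t \<bullet> s t) * indicator {0..real n} t \<partial>lebesgue)"
proof -
  let ?h = "\<lambda>n t. ennreal (s t \<bullet> s t) * indicator {0..real n} t"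
  have meas: "?h n \<in> borel_measurable lebesgue" for n
  proof -
    have "s \<in> borel_measurable (lebesgue_on {0..real n})"
      by (rule measurable_restrict_mono[OF s]) auto
    then have "(\<lambda>t. ennreal (s t \<bullet> s t)) \<in> borel_measurable (lebesgue_on {0..real n})"
      by measurable
    then show ?thesis
      by (subst (asm) borel_measurable_restrict_space_iff_ennreal) auto
  qed
  have "l2_norm_sq s = (\<integral>\<^sup>+ t. ennreal (s t \<bullet> s t) * indicator {0..} t \<partial>lebesgue)"
    unfolding l2_norm_sq_def by (subst nn_integral_restrict_space) auto
  also have "\<dots> = (\<integral>\<^sup>+ t. (SUP n. ?h n t) \<partial>lebesgue)"
  proof (rule nn_integral_cong)
    fix t :: real
    obtain m where m: "t \<le> real m" using real_arch_simple by blast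
    show "ennreal (s t \<bullet> s t) * indicator {0..} t = (SUP n. ?h n t)"
    proof (rule antisym)
      show "ennreal (s t \<bullet> s t) * indicator {0..} t \<le> (SUP n. ?h n t)"
        using m by (intro SUP_upper2[of m]) (auto simp: indicator_def)
      show "(SUP n. ?h n t) \<le> ennreal (s t \<bullet> s t) * indicator {0..} t"
        by (intro SUP_least) (auto simp: indicator_def)
    qed
  qed
  also have "\<dots> = (SUP n. integral\<^sup>N lebesgue (?h n))"
    using meas by (intro nn_integral_monotone_convergence_SUP)
      (auto simp: incseq_def le_fun_def indicator_def)
  finally show ?thesis .
qed

lemma l2_signal_absolutely_integrable:
  assumes "s \<in> l2_signals"
  shows "(\<lambda>t. s t \<bullet> s t) absolutely_integrable_on {0..}"
proof -
  have s: "s \<in> borel_measurable (lebesgue_on {0..})"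
    and fin: "(\<integral>\<^sup>+ t. ennreal (s t \<bullet> s t) \<partial>lebesgue_on {0..}) < \<infinity>"
    using assms by (auto simp: l2_signals_def l2_norm_sq_def)
  have "integrable (lebesgue_on {0..}) (\<lambda>t. s t \<bullet> s t)"
  proof (rule integrableI_bounded)
    show "(\<lambda>t. s t \<bullet> s t) \<in> borel_measurable (lebesgue_on {0..})"
      using s by measurable
  qed (use fin in simp)
  then show ?thesis
    by (subst (asm) integrable_restrict_space) (auto simp: set_integrable_def)
qed

text \<open>Integrating the dissipation inequality over [0, T] from V = 0 to a nonnegative final
  value leaves the output energy below \<gamma> times the disturbance energy; then T tends to
  infinity along the integers.\<close>

lemma l2_gain_min_switching:
  assumes N: "N \<ge> 1" and P: "\<forall>i\<in>{1..N}. pos_definite (P i)" and "\<gamma> \<ge> 0"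
    and diss: "\<And>x y w. (\<And>i. i \<in> active N (min_switching N P) x \<Longrightarrow> w i \<ge> 0) \<Longrightarrow>
        (\<Sum>i\<in>active N (min_switching N P) x. w i) = 1 \<Longrightarrow>
        (\<Sum>i\<in>active N (min_switching N P) x. w i * vdot (P i) x (A i *v x + E i *v y)) \<le>
          \<gamma> * (y \<bullet> y) - (norm (\<Sum>i\<in>active N (min_switching N P) x. w i *\<^sub>R (C i *v x + F i *v y)))\<^sup>2"
    and sol: "closed_loop_solution N A E P (min_switching N P) \<psi> x a" and x0: "x 0 = 0"
    and \<psi>: "\<psi> \<in> l2_signals"
  shows "l2_norm_sq (modified_output N C F (min_switching N P) \<psi> x a) \<le> ennreal \<gamma> * l2_norm_sq \<psi>"
proof -
  let ?I = "\<lambda>t. active N (min_switching N P) (x t)"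
  define z where "z = modified_output N C F (min_switching N P) \<psi> x a"
  have \<psi>m: "\<psi> \<in> borel_measurable (lebesgue_on {0..})" using \<psi> by (simp add: l2_signals_def)
  have zm: "z \<in> borel_measurable (lebesgue_on {0..})"
    unfolding z_def by (rule borel_measurable_modified_output[OF sol \<psi>m])
  have w: "\<And>i. i \<in> ?I t \<Longrightarrow> a i t \<ge> 0" "(\<Sum>i\<in>?I t. a i t) = 1" if "t \<ge> 0" for t
    using sol that by (auto simp: closed_loop_solution_def)
  obtain K where K: "K > 0" "\<And>i x y. i \<in> {1..N} \<Longrightarrow> norm (C i *v x + F i *v y) \<le> K * (norm x + norm y)"
    using affine_output_bound[of "{1..N}" C F] by auto
  \<comment> \<open>This pointwise bound, together with measurability, makes the squared output
    integrable on finite horizons, as integrating the dissipation inequality requires.\<close>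
  have zb: "z t \<bullet> z t \<le> 2 * K\<^sup>2 * (x t \<bullet> x t + \<psi> t \<bullet> \<psi> t)" if t: "t \<ge> 0" for t
  proof -
    have "norm (z t) \<le> (\<Sum>i\<in>?I t. a i t * (K * (norm (x t) + norm (\<psi> t))))"
      unfolding z_def modified_output_def
    proof (rule sum_norm_le)
      fix i assume i: "i \<in> ?I t"
      then have "i \<in> {1..N}" using active_subset by blast
      then show "norm (a i t *\<^sub>R (C i *v x t + F i *v \<psi> t)) \<le> a i t * (K * (norm (x t) + norm (\<psi> t)))"
        using w(1)[OF t i] K(2) by (auto intro: mult_left_mono)
    qed
    also have "\<dots> = K * (norm (x t) + norm (\<psi> t))"
      using w(2)[OF t] by (simp flip: sum_distrib_right)
    finally have "(norm (z t))\<^sup>2 \<le> (K * (norm (x t) + norm (\<psi> t)))\<^sup>2"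
      by (intro power_mono) auto
    also have "\<dots> = K\<^sup>2 * (norm (x t) + norm (\<psi> t))\<^sup>2" by (rule power_mult_distrib)
    also have "\<dots> \<le> K\<^sup>2 * (2 * ((norm (x t))\<^sup>2 + (norm (\<psi> t))\<^sup>2))"
      using sum_squares_bound[of "norm (x t)" "norm (\<psi> t)"]
      by (intro mult_left_mono) (auto simp: power2_sum)
    finally show ?thesis by (simp add: dot_square_norm algebra_simps)
  qed
  have \<psi>i: "(\<lambda>t. \<psi> t \<bullet> \<psi> t) absolutely_integrable_on {0..T}" for T
    by (rule set_integrable_subset[OF l2_signal_absolutely_integrable[OF \<psi>]]) auto
  have zi: "(\<lambda>t. z t \<bullet> z t) absolutely_integrable_on {0..T}" for T
  proof (rule measurable_bounded_by_integrable_imp_absolutely_integrable)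
    have "z \<in> borel_measurable (lebesgue_on {0..T})"
      by (rule measurable_restrict_mono[OF zm]) auto
    then show "(\<lambda>t. z t \<bullet> z t) \<in> borel_measurable (lebesgue_on {0..T})" by measurable
    have "continuous_on {0..T} x"
      by (rule continuous_on_subset[OF solution_continuous_on[OF sol]]) auto
    then have "(\<lambda>t. x t \<bullet> x t) integrable_on {0..T}"
      by (intro integrable_continuous_real continuous_intros)
    moreover have "(\<lambda>t. \<psi> t \<bullet> \<psi> t) integrable_on {0..T}"
      using \<psi>i by (simp add: absolutely_integrable_on_def)
    ultimately show "(\<lambda>t. 2 * K\<^sup>2 * (x t \<bullet> x t + \<psi> t \<bullet> \<psi> t)) integrable_on {0..T}"
      by (intro integrable_on_mult_right integrable_add)
  qed (use zb in auto)
  have step: "integral {0..T} (\<lambda>t. z t \<bullet> z t) \<le> \<gamma> * integral {0..T} (\<lambda>t. \<psi> t \<bullet> \<psi> t)" if T: "T \<ge> 0" for T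
  proof -
    have int: "(\<lambda>t. \<gamma> * (\<psi> t \<bullet> \<psi> t)) absolutely_integrable_on {0..T}"
      using \<psi>i by (intro set_integrable_mult_right)
    have "min_value N P (x T) - min_value N P (x 0) \<le> integral {0..T} (\<lambda>t. \<gamma> * (\<psi> t \<bullet> \<psi> t) - z t \<bullet> z t)"
    proof (rule closed_loop_min_value_bound[OF N sol order_refl T])
      show "(\<lambda>t. \<gamma> * (\<psi> t \<bullet> \<psi> t) - z t \<bullet> z t) absolutely_integrable_on {0..T}"
        using int zi by (rule set_integral_diff(1))
      fix t assume "t \<in> {0..T}"
      then have t: "t \<ge> 0" by simp
      show "(\<Sum>i\<in>?I t. a i t * vdot (P i) (x t) (vfield A E \<psi> i (x t) t)) \<le> \<gamma> * (\<psi> t \<bullet> \<psi> t) - z t \<bullet> z t"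
        using diss[of "x t" "\<lambda>i. a i t" "\<psi> t"] w[OF t]
        by (simp add: vfield_def z_def modified_output_def dot_square_norm)
    qed
    also have "\<dots> = \<gamma> * integral {0..T} (\<lambda>t. \<psi> t \<bullet> \<psi> t) - integral {0..T} (\<lambda>t. z t \<bullet> z t)"
      using int zi by (subst integral_diff) (auto simp: absolutely_integrable_on_def)
    finally have "min_value N P (x T) \<le> \<gamma> * integral {0..T} (\<lambda>t. \<psi> t \<bullet> \<psi> t) - integral {0..T} (\<lambda>t. z t \<bullet> z t)"
      using N x0 by simp
    moreover have "min_value N P (x T) \<ge> 0"
      using min_value_lower_bound[OF N P] by (meson inner_ge_zero less_imp_le mult_nonneg_nonneg order_trans)
    ultimately show ?thesis by simp
  qed
  have "l2_norm_sq z = (SUP n::nat. \<integral>\<^sup>+ t. ennreal (z t \<bullet> z t) * indicator {0..real n} t \<partial>lebesgue)"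
    by (rule l2_norm_sq_eq_SUP[OF zm])
  also have "\<dots> \<le> ennreal \<gamma> * l2_norm_sq \<psi>"
  proof (rule SUP_least)
    fix n :: nat
    have "(\<integral>\<^sup>+ t. ennreal (z t \<bullet> z t) * indicator {0..real n} t \<partial>lebesgue) = ennreal (integral {0..real n} (\<lambda>t. z t \<bullet> z t))"
      by (rule nn_integral_eq_integral_on[OF zi]) simp
    also have "\<dots> \<le> ennreal (\<gamma> * integral {0..real n} (\<lambda>t. \<psi> t \<bullet> \<psi> t))"
      by (intro ennreal_leI step) simp
    also have "\<dots> = ennreal \<gamma> * ennreal (integral {0..real n} (\<lambda>t. \<psi> t \<bullet> \<psi> t))"
      using \<open>\<gamma> \<ge> 0\<close> by (simp add: ennreal_mult')
    also have "ennreal (integral {0..real n} (\<lambda>t. \<psi> t \<bullet> \<psi> t)) =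
        (\<integral>\<^sup>+ t. ennreal (\<psi> t \<bullet> \<psi> t) * indicator {0..real n} t \<partial>lebesgue)"
      by (rule nn_integral_eq_integral_on[OF \<psi>i, symmetric]) simp
    also have "\<dots> \<le> l2_norm_sq \<psi>"
      unfolding l2_norm_sq_eq_SUP[OF \<psi>m] by (rule SUP_upper) simp
    finally show "(\<integral>\<^sup>+ t. ennreal (z t \<bullet> z t) * indicator {0..real n} t \<partial>lebesgue) \<le> ennreal \<gamma> * l2_norm_sq \<psi>"
      by (simp add: mult_left_mono)
  qed
  finally show ?thesis by (simp add: z_def)
qed

section \<open>Stability and gain from a common margin\<close>

theorem propositionA3:
  fixes N :: nat
    and A :: "nat \<Rightarrow> real^'n^'n"
    and E :: "nat \<Rightarrow> real^'q^'n"
    and C :: "nat \<Rightarrow> real^'n^'p"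
    and F :: "nat \<Rightarrow> real^'q^'p"
    and P :: "nat \<Rightarrow> real^'n^'n"
    and \<rho> :: real
    and \<pi> :: "nat \<Rightarrow> nat \<Rightarrow> real"
  assumes "N \<ge> 1"
    and "\<forall>i\<in>{1..N}. pos_definite (P i)"
    and "\<rho> > 0"
    and "\<pi> \<in> metzler_set N"
    and "\<forall>i\<in>{1..N}. neg_definite (block3
           (transpose (A i) ** P i + P i ** A i + (\<Sum>j\<in>{1..N}. \<pi> j i *\<^sub>R P j))
             (P i ** E i) (transpose (C i))
           (transpose (E i) ** P i) (- (\<rho> *\<^sub>R mat 1)) (transpose (F i))
           (C i) (F i) (- mat 1))"
  shows "origin_GAS N A E P (min_switching N P) \<and>
         J_infinity N A E C F P (min_switching N P) < ennreal \<rho>"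
proof -
  let ?lhs = "\<lambda>i x y. vdot (P i) x (A i *v x + E i *v y) + x \<bullet> ((\<Sum>j\<in>{1..N}. \<pi> j i *\<^sub>R P j) *v x)
                  + (norm (C i *v x + F i *v y))\<^sup>2"
  let ?rhs = "\<lambda>c (x::real^'n) (y::real^'q). (\<rho> - c) * (y \<bullet> y) - c * (x \<bullet> x)"
  have mono: "?rhs c x y \<le> ?rhs c' x y" if "c' \<le> c" for c c' x y
    using that by (intro diff_mono mult_right_mono) auto
  have "\<exists>c>0. \<forall>i\<in>{1..N}. \<forall>x y. ?lhs i x y \<le> ?rhs c x y"
  proof (rule finite_uniform_positive)
    show "\<exists>c>0. \<forall>x y. ?lhs i x y \<le> ?rhs c x y" if "i \<in> {1..N}" for i
      using assms(5) that by (intro bounded_real_lmi_dissipation) blast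
    show "\<forall>x y. ?lhs i x y \<le> ?rhs c' x y"
      if "\<forall>x y. ?lhs i x y \<le> ?rhs c x y" "0 < c'" "c' \<le> c" for i c c'
      using that mono by (meson order_trans)
  qed simp
  then obtain c0 where c0: "c0 > 0" "\<And>i x y. i \<in> {1..N} \<Longrightarrow> ?lhs i x y \<le> ?rhs c0 x y"
    by blast
  \<comment> \<open>Capping the margin at \<rho> makes \<rho> - c nonnegative, so that it is a
    genuine gain and \<open>ennreal\<close> does not truncate it.\<close>
  define c where "c = min c0 \<rho>"
  have c: "c > 0" "c \<le> \<rho>" using c0 assms(3) by (auto simp: c_def)
  have lmi: "?lhs i x y \<le> ?rhs c x y" if "i \<in> {1..N}" for i x y
    by (rule order_trans[OF c0(2)[OF that] mono]) (simp add: c_def)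
  note diss = switched_dissipation[OF assms(1,4) lmi]
  have "origin_GAS N A E P (min_switching N P)"
  proof (rule origin_GAS_min_switching[OF assms(1,2) c(1)])
    fix x :: "real^'n" and w :: "nat \<Rightarrow> real" assume w: "\<And>i. i \<in> active N (min_switching N P) x \<Longrightarrow> w i \<ge> 0"
      "(\<Sum>i\<in>active N (min_switching N P) x. w i) = 1"
    have "(\<Sum>i\<in>active N (min_switching N P) x. w i * vdot (P i) x (A i *v x + E i *v 0))
        \<le> ?rhs c x 0 - (norm (\<Sum>i\<in>active N (min_switching N P) x. w i *\<^sub>R (C i *v x + F i *v 0)))\<^sup>2"
      by (rule diss) (use w in auto)
    also have "\<dots> \<le> - c * (x \<bullet> x)" by simp
    finally show "(\<Sum>i\<in>active N (min_switching N P) x. w i * vdot (P i) x (A i *v x)) \<le> - c * (x \<bullet> x)"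
      by simp
  qed
  \<comment> \<open>The margin \<open>c\<close> is the same for all disturbances and solutions, so
    the inequality with \<rho> remains strict after taking the supremum.\<close>
  moreover have "J_infinity N A E C F P (min_switching N P) \<le> ennreal (\<rho> - c)"
    unfolding J_infinity_def
  proof (rule Sup_least, safe)
    fix \<psi> x a
    assume h: "\<psi> \<in> l2_signals" "l2_norm_sq \<psi> \<noteq> 0"
      "closed_loop_solution N A E P (min_switching N P) \<psi> x a" "x 0 = 0"
    have "l2_norm_sq (modified_output N C F (min_switching N P) \<psi> x a) \<le> ennreal (\<rho> - c) * l2_norm_sq \<psi>"
    proof (rule l2_gain_min_switching[OF assms(1,2) _ _ h(3,4,1)])
      fix x :: "real^'n" and y :: "real^'q" and w :: "nat \<Rightarrow> real" assume w: "\<And>i. i \<in> active N (min_switching N P) x \<Longrightarrow> w i \<ge> 0"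
        "(\<Sum>i\<in>active N (min_switching N P) x. w i) = 1"
      have "c * (x \<bullet> x) \<ge> 0" using c by simp
      then show "(\<Sum>i\<in>active N (min_switching N P) x. w i * vdot (P i) x (A i *v x + E i *v y))
        \<le> (\<rho> - c) * (y \<bullet> y) - (norm (\<Sum>i\<in>active N (min_switching N P) x. w i *\<^sub>R (C i *v x + F i *v y)))\<^sup>2"
        using diss[of x w y, OF _ w] by simp
    qed (use c in simp)
    moreover have "l2_norm_sq \<psi> < top" using h(1) by (simp add: l2_signals_def)
    ultimately show "l2_norm_sq (modified_output N C F (min_switching N P) \<psi> x a) / l2_norm_sq \<psi> \<le> ennreal (\<rho> - c)"
      using h(2) by (metis divide_right_mono_ennreal ennreal_mult_divide_eq less_irrefl)
  qed
  moreover have "ennreal (\<rho> - c) < ennreal \<rho>"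
    using c by (simp add: ennreal_lessI)
  ultimately show ?thesis by (meson le_less_trans)
qed

end
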